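(* Consider $m=m_n\to\infty$ independent change point problems as described in the context, where $\xi$ is symmetric about $0$ with $\mathbb P(|\xi|\ge t)=\frac{1}{1+t^\gamma}$ for all $t\ge0$, with tail index $\gamma>0$. (1) Let $\hat d_i^{\ell_2}$ be the change point estimator for the $i$-th problem obtained by minimizing the squared error loss. If $n/m^{1/\gamma}\to\infty$, then for every $t>0$, $$\liminf_{n\to\infty}\mathbb P\Big(\max_{1\le i\le m}\frac{n}{m^{1/\gamma}}\big|\hat d_i^{\ell_2}-d_{0,i}\big|>t\Big)\ge c(t)>0,$$ where $c(t)$ is some positive constant depending on $t$ and on the other model parameters. (2) Let $\hat d_i^{\ell_1}$ be the estimator for the $i$-th problem obtained by minimizing the $\ell_1$ criterion. Then, for $t>0$, $$\mathbb P\Big(\frac{n}{\log m}\max_{1\le i\le m}\big|\hat d_i^{\ell_1}-d_{0,i}\big|>t\Big)\le\frac{2e^{-c}}{1-e^{-c}}\,e^{-\log m\left(t\frac{f_X(d_0)}{2}(1-e^{-c})-1\right)},$$ as long as $n/\log m\to\infty$, where $c=\mu^2/(4b^2)$, $\mu=\mathbb E[|\xi+1|-|\xi|]$ and $b$ is the range of the random variable $(|\xi+1|-|\xi|)-\mu$.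
   Context: Setting: for $1\le i\le m$, $1\le j\le n$, one observes $(X_{i,j},Y_{i,j})$ with $Y_{i,j}=\mathbf 1_{X_{i,j}>d_{0,i}}+\xi_{i,j}$, where all pairs $(X_{i,j},\xi_{i,j})$ are i.i.d. copies of $(X,\xi)$, $\xi$ is independent of $X$, and $X$ has a continuous density $f_X$ that is strictly positive at the true change point. The change points $d_{0,1},\dots,d_{0,m}$ are free parameters, and $d_{0,i}$ is estimated only from the $n$ observations of the $i$-th problem: $\hat d_i^{\ell_2}$ is the smallest minimizer over $d$ of $\sum_{j=1}^n(Y_{i,j}-\mathbf 1_{X_{i,j}>d})^2$, and $\hat d_i^{\ell_1}$ is the smallest minimizer over $d$ of $\sum_{j=1}^n|Y_{i,j}-\mathbf 1_{X_{i,j}>d}|$. Notation: $f_X(d_0)$ is the density of $X$ at the true change point of a generic problem; the index $i$ of $d_{0,i}$ is dropped, the law of $n(\hat d_i-d_{0,i})$ being treated as the same for every $i$. *)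

theory Defs
  imports "HOL-Probability.Probability"
begin

text \<open>
  One infinite array of observations, indexed from 0: at sample size \<open>n\<close> with \<open>m\<close> problems only the
  pairs with \<open>i < m\<close> and \<open>j < n\<close> are used.  \<open>f\<close> is the density of the covariate, \<open>N\<close> the law of the
  noise and \<open>d0 i\<close> the true change point of problem \<open>i\<close>.

  The last three assumptions make precise that the law of the rescaled error of an estimator is treated
  as the same for every \<open>i\<close>.  In the limit this law depends on \<open>i\<close> only through the behaviour of \<open>f\<close> near \<open>d0 i\<close>:
  the density takes one common value \<open>fd0\<close> at all change points, and its continuity there is uniform
  in \<open>i\<close>.  Given that \<open>f\<close> is continuous, the last assumption holds whenever the change points are
  bounded, in particular when they coincide.
\<close>

locale change_point_problems = prob_space M
  for M :: "'a measure" +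
  fixes f :: "real \<Rightarrow> real" and fd0 :: real
    and N :: "real measure"
    and d0 :: "nat \<Rightarrow> real"
    and X \<xi> :: "nat \<Rightarrow> nat \<Rightarrow> 'a \<Rightarrow> real"
  assumes density_nonneg: "\<And>x. 0 \<le> f x"
    and density_continuous: "continuous_on UNIV f"
    and X_distributed: "\<And>i j. distributed M lborel (X i j) (\<lambda>x. ennreal (f x))"
    and noise_random_variable: "\<And>i j. \<xi> i j \<in> borel_measurable M"
    and noise_law: "\<And>i j. distr M borel (\<xi> i j) = N"
    and noise_indep: "\<And>i j. indep_var borel (X i j) borel (\<xi> i j)"
    and pairs_indep:
      "indep_vars (\<lambda>_. borel \<Otimes>\<^sub>M borel) (\<lambda>(i, j) \<omega>. (X i j \<omega>, \<xi> i j \<omega>)) UNIV"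
    and density_pos: "0 < fd0"
    and density_at_change_point: "\<And>i. f (d0 i) = fd0"
    and density_uniformly_continuous_at_change_points:
      "uniform_limit UNIV (\<lambda>u i. f (d0 i + u)) (\<lambda>i. f (d0 i)) (at 0)"

definition response :: "real \<Rightarrow> real \<Rightarrow> real \<Rightarrow> real" where
  "response d x e = indicator {d<..} x + e"

definition l2_loss :: "nat \<Rightarrow> (nat \<Rightarrow> real) \<Rightarrow> (nat \<Rightarrow> real) \<Rightarrow> real \<Rightarrow> real" where
  "l2_loss n x y d = (\<Sum>j<n. (y j - indicator {d<..} (x j))\<^sup>2)"

definition l1_loss :: "nat \<Rightarrow> (nat \<Rightarrow> real) \<Rightarrow> (nat \<Rightarrow> real) \<Rightarrow> real \<Rightarrow> real" where
  "l1_loss n x y d = (\<Sum>j<n. \<bar>y j - indicator {d<..} (x j)\<bar>)"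

text \<open>
  As functions of \<open>d\<close> the losses are right-continuous step functions that jump at the \<open>x j\<close>.  Hence the
  infimum of the set of minimizers is a minimizer, except when the values of \<open>d\<close> below all the \<open>x j\<close>
  are minimizers.  There is then no smallest real one, and the smallest minimizer is taken to be
  \<open>-\<infinity>\<close>.
\<close>

definition smallest_minimizer :: "(real \<Rightarrow> real) \<Rightarrow> ereal" where
  "smallest_minimizer Q = Inf (ereal ` {d. is_arg_min Q (\<lambda>_. True) d})"

definition l2_estimator ::
  "(nat \<Rightarrow> real) \<Rightarrow> (nat \<Rightarrow> nat \<Rightarrow> 'a \<Rightarrow> real) \<Rightarrow> (nat \<Rightarrow> nat \<Rightarrow> 'a \<Rightarrow> real) \<Rightarrow> nat \<Rightarrow> nat \<Rightarrow> 'a \<Rightarrow> ereal"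
  where
  "l2_estimator d0 X \<xi> n i \<omega> =
     smallest_minimizer (l2_loss n (\<lambda>j. X i j \<omega>) (\<lambda>j. response (d0 i) (X i j \<omega>) (\<xi> i j \<omega>)))"

definition l1_estimator ::
  "(nat \<Rightarrow> real) \<Rightarrow> (nat \<Rightarrow> nat \<Rightarrow> 'a \<Rightarrow> real) \<Rightarrow> (nat \<Rightarrow> nat \<Rightarrow> 'a \<Rightarrow> real) \<Rightarrow> nat \<Rightarrow> nat \<Rightarrow> 'a \<Rightarrow> ereal"
  where
  "l1_estimator d0 X \<xi> n i \<omega> =
     smallest_minimizer (l1_loss n (\<lambda>j. X i j \<omega>) (\<lambda>j. response (d0 i) (X i j \<omega>) (\<xi> i j \<omega>)))"

text \<open>
  The range of a random variable is the length of its essential range, that is, its essential supremum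
  minus its essential infimum.
\<close>

definition essential_range_length :: "'a measure \<Rightarrow> ('a \<Rightarrow> real) \<Rightarrow> real" where
  "essential_range_length M Z =
     real_of_ereal (esssup M (\<lambda>\<omega>. ereal (Z \<omega>)) + esssup M (\<lambda>\<omega>. ereal (- Z \<omega>)))"

end

theory Submission
  imports Defs
begin

text \<open>
  Both losses depend on \<open>d\<close> only through the signs of \<open>x j - d\<close>, so the comparison of a candidate \<open>d\<close> with
  the truth \<open>d0\<close> is a sum over the observations whose covariate lies between the two
  (\<open>m_loss_response_diff\<close>).  To the right of \<open>d0\<close> the summands are \<open>2 \<xi> + 1\<close> for the squared loss and
  \<open>\<phi> \<xi> = |\<xi> + 1| - |\<xi>|\<close> for the absolute loss; to the left \<open>\<xi>\<close> is replaced by \<open>- \<xi>\<close>.  The first kind of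
  summand inherits the heavy tail of the noise, the second takes values in \<open>[-1, 1]\<close>, and this is the whole
  difference between the two estimators.

  Squared loss.  Put \<open>k = m powr (1 / \<gamma>)\<close> and \<open>s = t k / n\<close>.  The window around a change point of width of
  order \<open>s\<close> contains about a constant times \<open>k\<close> observations.  Their noise is typically at most
  \<open>\<tau>\<close> of order \<open>k powr (1 / \<gamma>)\<close>, so they move the loss by at most a multiple of \<open>k \<tau>\<close>.  One observation
  beyond \<open>d0 + 2 s\<close> with noise below \<open>- T\<close>, where \<open>T\<close> is a larger multiple of \<open>k \<tau>\<close>, then forces the
  minimizer away from \<open>d0\<close> (\<open>l2_minimizer_follows_jump\<close>).  Such a jump has probability of order
  \<open>s / T powr \<gamma>\<close>, that is, \<open>1 / (m n)\<close>, and there are \<open>m n\<close> observations.  The events that a given observation is the only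
  jump and is not disturbed by the others are disjoint, and each has at least a quarter of the
  probability of the jump by a union bound and Markov's inequality (\<open>isolated_jump_prob\<close>).

  Absolute loss.  Since \<open>\<phi> \<xi>\<close> has mean \<open>\<mu> > 0\<close>, one has \<open>\<rho> = E exp (- l \<phi> \<xi>) < 1\<close> for \<open>l = \<mu> / 2\<close>.  The
  estimator can be farther than \<open>s\<close> from \<open>d0\<close> only if the sum of the \<open>\<phi> \<xi>\<close> over an interval from \<open>d0\<close>
  to some \<open>d\<close> beyond \<open>d0 \<plusminus> s\<close> is nonpositive.  Cut the possible end points \<open>d\<close> into cells of
  probability \<open>1 / n\<close>.  For an interval of probability \<open>q\<close> the Laplace transform of the sum is at most
  \<open>exp (- (1 - \<rho>) n q)\<close>, and moving the end point within one cell costs a bounded factor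
  (\<open>sandwiched_sum_bound\<close>).  The bounds of consecutive cells decrease geometrically, so the sum over all cells is
  of the order of the first one, \<open>exp (- (1 - \<rho>) n s fd0)\<close>, with no factor depending on \<open>n\<close>
  (\<open>chain_sum_bound\<close>).  With \<open>s = t log m / n\<close> and a union over the \<open>m\<close> problems this gives a power of \<open>m\<close>
  with an exponent strictly better than the one claimed, because \<open>1 - \<rho> \<ge> 1 - exp (- c)\<close> and the rate \<open>fd0\<close>
  is twice \<open>fd0 / 2\<close>; for large \<open>m\<close> the gain in the exponent absorbs every constant.
\<close>

section \<open>Smallest minimizers of step functions\<close>

text \<open>
  The property of both losses, that they jump only at the covariates, from which the existence, approximation
  and measurability of their minimizers follow.
\<close>

locale step_criterion =
  fixes n :: nat and x :: "nat \<Rightarrow> real" and Q :: "real \<Rightarrow> real"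
  assumes same_value: "(\<And>j. j < n \<Longrightarrow> d < x j \<longleftrightarrow> d' < x j) \<Longrightarrow> Q d = Q d'"
begin

text \<open>
  The criterion takes finitely many values, at most one for each subset of the indices.
\<close>

lemma minimizer_exists: "\<exists>d. \<forall>d'. Q d \<le> Q d'"
proof -
  define S where "S d = {j. j < n \<and> d < x j}" for d
  have "range Q \<subseteq> (\<lambda>A. Q (SOME d. S d = A)) ` Pow {..<n}"
  proof
    fix v assume "v \<in> range Q"
    then obtain d where v: "v = Q d" by auto
    have "S (SOME d'. S d' = S d) = S d" by (rule someI) simp
    then have "v = Q (SOME d'. S d' = S d)"
      unfolding v by (intro same_value) (auto simp: S_def)
    moreover have "S d \<in> Pow {..<n}" by (auto simp: S_def)
    ultimately show "v \<in> (\<lambda>A. Q (SOME d. S d = A)) ` Pow {..<n}" by (rule image_eqI)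
  qed
  then have fin: "finite (range Q)" by (rule finite_subset) simp
  then have "Min (range Q) \<in> range Q" by (intro Min_in) auto
  then obtain d where "Min (range Q) = Q d" by auto
  then have "\<forall>d'. Q d \<le> Q d'" using fin by (metis Min_le rangeI)
  then show ?thesis ..
qed

text \<open>
  The criterion is constant on a right neighbourhood of every point, and the rationals are dense.
\<close>

lemma rational_point_same_value:
  assumes "d < a"
  obtains q where "q \<in> \<rat>" "d < q" "q < a" "Q q = Q d"
proof -
  \<comment> \<open>the jumps of the criterion in \<open>]d, \<infinity>[\<close> stay at or above \<open>B\<close>\<close>
  define B where "B = Min (insert a (x ` {j. j < n \<and> d < x j}))"
  have "d < B" unfolding B_def using assms by (subst Min_gr_iff) auto
  then obtain q where q: "q \<in> \<rat>" "d < q" "q < B"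
    using Rats_dense_in_real by blast
  have "B \<le> a" unfolding B_def by (intro Min_le) auto
  moreover have "B \<le> x j" if "j < n" "d < x j" for j
    unfolding B_def using that by (intro Min_le) auto
  then have "Q q = Q d" using q by (intro same_value) force
  ultimately show thesis using q by (intro that[of q]) auto
qed

lemma is_arg_min_rational:
  assumes "\<forall>r\<in>\<rat>. Q d \<le> Q r"
  shows "is_arg_min Q (\<lambda>_. True) d"
  unfolding is_arg_min_linorder
proof safe
  fix y
  obtain q where "q \<in> \<rat>" "Q q = Q y" using rational_point_same_value[of y "y + 1"] by auto
  then show "Q d \<le> Q y" using assms by metis
qed

text \<open>
  The infimum over a countable set makes the estimators measurable.
\<close>

lemma smallest_minimizer_eq_INF:
  "smallest_minimizer Q = (INF q\<in>\<rat>. if \<forall>r\<in>\<rat>. Q q \<le> Q r then ereal q else \<infinity>)"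
  (is "_ = ?I")
proof (rule antisym)
  show "smallest_minimizer Q \<le> ?I"
  proof (rule INF_greatest)
    fix q
    show "smallest_minimizer Q \<le> (if \<forall>r\<in>\<rat>. Q q \<le> Q r then ereal q else \<infinity>)"
      unfolding smallest_minimizer_def
      by (simp add: Inf_lower is_arg_min_rational)
  qed
  show "?I \<le> smallest_minimizer Q"
    unfolding smallest_minimizer_def
  proof (rule Inf_greatest)
    fix v assume "v \<in> ereal ` {d. is_arg_min Q (\<lambda>_. True) d}"
    then obtain d where v: "v = ereal d" and d: "\<And>y. Q d \<le> Q y"
      by (auto simp: is_arg_min_linorder)
    show "?I \<le> v" unfolding v
    proof (rule ereal_le_epsilon2)
      fix e :: real assume "0 < e"
      then obtain q where q: "q \<in> \<rat>" "q < d + e" "Q q = Q d"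
        using rational_point_same_value[of d "d + e"] by auto
      have "?I \<le> (if \<forall>r\<in>\<rat>. Q q \<le> Q r then ereal q else \<infinity>)" by (rule INF_lower) fact
      also have "\<dots> = ereal q" using d q(3) by auto
      also have "\<dots> \<le> ereal d + ereal e" using q(2) by simp
      finally show "?I \<le> ereal d + ereal e" .
    qed
  qed
qed

text \<open>
  On the left the infimum of the minimizers can be approached by minimizers (it need not be one, and may be
  \<open>-\<infinity>\<close>); on the right every minimizer lies beyond it.
\<close>

lemma smallest_minimizer_far:
  assumes far: "ereal s < \<bar>smallest_minimizer Q - ereal d0\<bar>" and "0 \<le> s"
  obtains d where "s < \<bar>d - d0\<bar>" "Q d \<le> Q d0"
proof -
  define I where "I = smallest_minimizer Q"
  have "I < ereal (d0 - s) \<or> ereal (d0 + s) < I"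
    using far unfolding I_def[symmetric] by (cases I) (auto simp: abs_real_def split: if_splits)
  then show thesis
  proof
    assume "I < ereal (d0 - s)"
    then obtain d where "is_arg_min Q (\<lambda>_. True) d" "d < d0 - s"
      unfolding I_def smallest_minimizer_def Inf_less_iff by auto
    then show thesis using \<open>0 \<le> s\<close> by (intro that[of d]) (auto simp: is_arg_min_linorder)
  next
    assume *: "ereal (d0 + s) < I"
    obtain d where d: "\<And>y. Q d \<le> Q y" using minimizer_exists by auto
    then have "I \<le> ereal d"
      unfolding I_def smallest_minimizer_def
      by (intro Inf_lower imageI) (auto simp: is_arg_min_linorder)
    with * have "ereal (d0 + s) < ereal d" by (rule less_le_trans)
    then show thesis using \<open>0 \<le> s\<close> d by (intro that[of d]) auto
  qed
qed

end

text \<open>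
  The factor 2 leaves room for the infimum of the minimizers not to be attained.
\<close>

lemma smallest_minimizer_escapes:
  assumes worse: "\<And>d. \<bar>d - d0\<bar> \<le> 2 * s \<Longrightarrow> Q d' < Q d" and "0 < s"
  shows "ereal s < \<bar>smallest_minimizer Q - ereal d0\<bar>"
proof (rule ccontr)
  define I where "I = smallest_minimizer Q"
  assume "\<not> ?thesis"
  then have near: "\<bar>I - ereal d0\<bar> \<le> ereal s" by (simp add: I_def not_less)
  then obtain v where v: "I = ereal v" by (cases I) auto
  with near have "\<bar>v - d0\<bar> \<le> s" by simp
  with \<open>0 < s\<close> have I: "I < ereal (d0 + 2 * s)" "ereal (d0 - 2 * s) < I" by (auto simp: v)
  from I(1) obtain d where d: "is_arg_min Q (\<lambda>_. True) d" "d < d0 + 2 * s"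
    unfolding I_def smallest_minimizer_def Inf_less_iff by auto
  have "I \<le> ereal d" unfolding I_def smallest_minimizer_def
    using d(1) by (intro Inf_lower) auto
  with I(2) have "ereal (d0 - 2 * s) < ereal d" by (rule less_le_trans)
  with d have "Q d' < Q d" by (intro worse) auto
  with d(1) show False by (auto simp: is_arg_min_linorder leD)
qed

definition m_loss :: "(real \<Rightarrow> real) \<Rightarrow> nat \<Rightarrow> (nat \<Rightarrow> real) \<Rightarrow> (nat \<Rightarrow> real) \<Rightarrow> real \<Rightarrow> real" where
  "m_loss r n x y d = (\<Sum>j<n. r (y j - indicator {d<..} (x j)))"

lemma l2_loss_eq_m_loss: "l2_loss = m_loss (\<lambda>z. z\<^sup>2)"
  by (simp add: fun_eq_iff l2_loss_def m_loss_def)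

lemma l1_loss_eq_m_loss: "l1_loss = m_loss abs"
  by (simp add: fun_eq_iff l1_loss_def m_loss_def)

lemma step_criterion_m_loss: "step_criterion n x (m_loss r n x y)"
proof
  fix d d' assume *: "\<And>j. j < n \<Longrightarrow> d < x j \<longleftrightarrow> d' < x j"
  have "indicator {d<..} (x j) = (indicator {d'<..} (x j) :: real)" if "j < n" for j
    using *[OF that] by (simp add: indicator_def)
  then show "m_loss r n x y d = m_loss r n x y d'"
    unfolding m_loss_def by (intro sum.cong) auto
qed

text \<open>
  At most one of the two sums is nonempty: only observations between \<open>d0\<close> and \<open>d\<close> are classified
  differently by the two points.
\<close>

lemma m_loss_response_diff:
  "m_loss r n x (\<lambda>j. response d0 (x j) (e j)) d - m_loss r n x (\<lambda>j. response d0 (x j) (e j)) d0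
   = (\<Sum>j | j < n \<and> x j \<in> {d0<..d}. r (e j + 1) - r (e j))
     + (\<Sum>j | j < n \<and> x j \<in> {d<..d0}. r (e j - 1) - r (e j))"
proof -
  have *: "(\<Sum>j | j < n \<and> x j \<in> A. g j) = (\<Sum>j<n. if x j \<in> A then g j else 0)"
    for A and g :: "nat \<Rightarrow> real"
    using sum.inter_filter[of "{..<n}" g "\<lambda>j. x j \<in> A"] by simp
  show ?thesis
    unfolding * m_loss_def sum_subtractf[symmetric] sum.distrib[symmetric]
    by (intro sum.cong refl) (simp add: response_def indicator_def add.commute)
qed

lemma measurable_INF_rational_minimizers:
  fixes Q :: "'b \<Rightarrow> real \<Rightarrow> real"
  assumes [measurable]: "\<And>d. (\<lambda>\<omega>. Q \<omega> d) \<in> borel_measurable M"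
  shows "(\<lambda>\<omega>. INF q\<in>\<rat>. if \<forall>r\<in>\<rat>. Q \<omega> q \<le> Q \<omega> r then ereal q else \<infinity>) \<in> borel_measurable M"
proof (rule borel_measurable_INF)
  fix q :: real
  have "(\<forall>r\<in>\<rat>. Q \<omega> q \<le> Q \<omega> r) \<longleftrightarrow> (\<forall>r :: rat. Q \<omega> q \<le> Q \<omega> (of_rat r))" for \<omega>
    by (simp add: Rats_def)
  then show "(\<lambda>\<omega>. if \<forall>r\<in>\<rat>. Q \<omega> q \<le> Q \<omega> r then ereal q else \<infinity>) \<in> borel_measurable M"
    by simp
qed (rule countable_rat)

lemma measurable_smallest_minimizer_m_loss:
  assumes [measurable]: "r \<in> borel_measurable borel"
    and [measurable]: "\<And>j. X j \<in> borel_measurable M" "\<And>j. Y j \<in> borel_measurable M"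
  shows "(\<lambda>\<omega>. smallest_minimizer (m_loss r n (\<lambda>j. X j \<omega>) (\<lambda>j. Y j \<omega>))) \<in> borel_measurable M"
  unfolding step_criterion.smallest_minimizer_eq_INF[OF step_criterion_m_loss]
proof (rule measurable_INF_rational_minimizers)
  fix d :: real
  show "(\<lambda>\<omega>. m_loss r n (\<lambda>j. X j \<omega>) (\<lambda>j. Y j \<omega>) d) \<in> borel_measurable M"
    unfolding m_loss_def by measurable
qed

section \<open>The law of the observations\<close>

context change_point_problems
begin

abbreviation X_law :: "real measure" where
  "X_law \<equiv> density lborel (\<lambda>x. ennreal (f x))"

lemma X_measurable [measurable]: "X i j \<in> borel_measurable M"
  using distributed_measurable[OF X_distributed[of i j]] by simp

lemma noise_measurable [measurable]: "\<xi> i j \<in> borel_measurable M"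
  by (rule noise_random_variable)

lemma f_measurable [measurable]: "f \<in> borel_measurable borel"
  using density_continuous by (rule borel_measurable_continuous_onI)

lemma distr_X: "distr M borel (X i j) = X_law"
proof -
  have "distr M borel (X i j) = distr M lborel (X i j)" by (intro distr_cong) auto
  then show ?thesis using distributed_distr_eq_density[OF X_distributed[of i j]] by simp
qed

lemma sets_N [simp, measurable_cong]: "sets N = sets borel"
  using noise_law[of 0 0] by (metis sets_distr)

lemma space_N [simp]: "space N = UNIV"
  using sets_eq_imp_space_eq[OF sets_N] by simp

lemma prob_space_N: "prob_space N"
  using noise_law[of 0 0] by (metis prob_space_distr noise_measurable)

lemma real_distribution_X_law: "real_distribution X_law"
proof -
  have "prob_space X_law" using distr_X[of 0 0] by (metis prob_space_distr X_measurable)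
  then show ?thesis
    by (auto simp: real_distribution_def real_distribution_axioms_def)
qed

sublocale X_law: real_distribution X_law
  by (rule real_distribution_X_law)

sublocale N: prob_space N
  by (rule prob_space_N)

lemma prob_X:
  assumes [measurable]: "A \<in> sets borel"
  shows "prob {\<omega> \<in> space M. X i j \<omega> \<in> A} = measure X_law A"
  by (subst distr_X[of i j, symmetric], subst measure_distr)
     (auto simp: vimage_def Int_def conj_commute)

lemma integral_noise:
  fixes g :: "real \<Rightarrow> real"
  assumes [measurable]: "g \<in> borel_measurable borel"
  shows "(\<integral>\<omega>. g (\<xi> i j \<omega>) \<partial>M) = (\<integral>e. g e \<partial>N)"
  unfolding noise_law[of i j, symmetric] by (rule integral_distr[symmetric]) auto

lemma X_law_singleton: "measure X_law {x} = 0"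
proof -
  have "emeasure X_law {x} = 0"
    by (subst emeasure_density) (auto intro!: nn_integral_null_set simp: null_sets_def)
  then show ?thesis by (simp add: measure_def)
qed

lemma isCont_cdf_X_law: "isCont (cdf X_law) x"
  by (simp add: X_law.isCont_cdf X_law_singleton)

text \<open>
  The constants \<open>3/4\<close> and 2 only need to lie strictly between \<open>1/2\<close> and 1, respectively above 1.  The
  first condition is what makes the rate of the absolute-loss bound strictly better than \<open>fd0 / 2\<close>.
\<close>

lemma X_law_window:
  obtains \<delta> where "0 < \<delta>"
    "\<And>i a b. \<lbrakk>-\<delta> < a; a \<le> b; b < \<delta>\<rbrakk> \<Longrightarrow> 3/4 * fd0 * (b - a) \<le> measure X_law {d0 i + a <.. d0 i + b}"
    "\<And>i a b. \<lbrakk>-\<delta> < a; a \<le> b; b < \<delta>\<rbrakk> \<Longrightarrow> measure X_law {d0 i + a <.. d0 i + b} \<le> 2 * fd0 * (b - a)"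
proof -
  have "0 < fd0 / 4" using density_pos by simp
  from uniform_limitD[OF density_uniformly_continuous_at_change_points this]
  obtain \<delta> where \<delta>: "0 < \<delta>"
    and near: "\<And>u i. u \<noteq> 0 \<Longrightarrow> dist u 0 < \<delta> \<Longrightarrow> dist (f (d0 i + u)) (f (d0 i)) < fd0 / 4"
    unfolding eventually_at by auto
  have f_near: "3/4 * fd0 \<le> f x \<and> f x \<le> 2 * fd0" if "\<bar>x - d0 i\<bar> < \<delta>" for x i
  proof (cases "x = d0 i")
    case True
    then show ?thesis using density_at_change_point density_pos by auto
  next
    case False
    then have "dist (f x) fd0 < fd0 / 4"
      using near[of "x - d0 i" i] that density_at_change_point[of i] by (simp add: dist_real_def)
    then show ?thesis using density_pos by (simp add: dist_real_def abs_real_def split: if_splits)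
  qed
  have em: "emeasure X_law A = (\<integral>\<^sup>+x. ennreal (f x) * indicator A x \<partial>lborel)" if "A \<in> sets borel" for A
    using that by (subst emeasure_density) auto
  have lo: "3/4 * fd0 * (b - a) \<le> measure X_law {d0 i + a <.. d0 i + b}"
    and hi: "measure X_law {d0 i + a <.. d0 i + b} \<le> 2 * fd0 * (b - a)"
    if ab: "-\<delta> < a" "a \<le> b" "b < \<delta>" for i a b
  proof -
    let ?A = "{d0 i + a <.. d0 i + b}"
    have c: "(\<integral>\<^sup>+x. ennreal c * indicator ?A x \<partial>lborel) = ennreal (c * (b - a))" if "0 \<le> c" for c
      using that ab by (subst nn_integral_cmult_indicator) (auto simp: ennreal_mult)
    have "(\<integral>\<^sup>+x. ennreal (3/4 * fd0) * indicator ?A x \<partial>lborel) \<le> emeasure X_law ?A"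
      using f_near[of _ i] ab by (subst em) (auto intro!: nn_integral_mono ennreal_leI simp: indicator_def)
    then show "3/4 * fd0 * (b - a) \<le> measure X_law ?A"
      using density_pos ab by (subst (asm) c) (auto simp: X_law.emeasure_eq_measure)
    have "emeasure X_law ?A \<le> (\<integral>\<^sup>+x. ennreal (2 * fd0) * indicator ?A x \<partial>lborel)"
      using f_near[of _ i] ab by (subst em) (auto intro!: nn_integral_mono ennreal_leI simp: indicator_def)
    then show "measure X_law ?A \<le> 2 * fd0 * (b - a)"
      using density_pos ab by (subst (asm) c) (auto simp: X_law.emeasure_eq_measure)
  qed
  from \<delta> lo hi show thesis by (rule that)
qed

end

section \<open>Sums of bounded scores over growing intervals\<close>

context change_point_problems
begin

lemma indep_var_X_noise_fun:
  fixes g h :: "real \<Rightarrow> real"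
  assumes [measurable]: "g \<in> borel_measurable borel" "h \<in> borel_measurable borel"
  shows "indep_var borel (\<lambda>\<omega>. g (X i j \<omega>)) borel (\<lambda>\<omega>. h (\<xi> i j \<omega>))"
  using indep_var_compose[OF noise_indep, of g borel h borel i j] by (simp add: comp_def)

lemma integral_indicator_times_noise:
  assumes [measurable]: "A \<in> sets borel" "g \<in> borel_measurable borel" and bound: "\<And>e. \<bar>g e\<bar> \<le> B"
  shows "(\<integral>\<omega>. indicator A (X i j \<omega>) * g (\<xi> i j \<omega>) \<partial>M) = measure X_law A * (\<integral>e. g e \<partial>N)"
    and "integrable M (\<lambda>\<omega>. indicator A (X i j \<omega>) * g (\<xi> i j \<omega>) :: real)"
proof -
  have ind: "indep_var borel (\<lambda>\<omega>. indicator A (X i j \<omega>) :: real) borel (\<lambda>\<omega>. g (\<xi> i j \<omega>))"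
    by (rule indep_var_X_noise_fun) auto
  have "integrable M (\<lambda>\<omega>. indicator A (X i j \<omega>) :: real)"
    by (rule integrable_const_bound[where B = 1]) (auto simp: indicator_def)
  moreover have "integrable M (\<lambda>\<omega>. g (\<xi> i j \<omega>))"
    using bound by (intro integrable_const_bound[where B = B]) auto
  ultimately have int: "integrable M (\<lambda>\<omega>. indicator A (X i j \<omega>) :: real)" "integrable M (\<lambda>\<omega>. g (\<xi> i j \<omega>))" .
  have "(\<integral>\<omega>. indicator A (X i j \<omega>) \<partial>M) = (\<integral>\<omega>. indicator {\<omega> \<in> space M. X i j \<omega> \<in> A} \<omega> \<partial>M)"
    by (intro Bochner_Integration.integral_cong) (auto simp: indicator_def)
  also have "\<dots> = measure X_law A" by (simp add: prob_X[of A i j])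
  finally show "(\<integral>\<omega>. indicator A (X i j \<omega>) * g (\<xi> i j \<omega>) \<partial>M) = measure X_law A * (\<integral>e. g e \<partial>N)"
    using indep_var_lebesgue_integral[OF ind int] by (simp add: integral_noise)
  show "integrable M (\<lambda>\<omega>. indicator A (X i j \<omega>) * g (\<xi> i j \<omega>) :: real)"
    using indep_var_integrable[OF ind int] .
qed

text \<open>
  Regrouping the independent family into singletons carries independence over to the reindexed family.
\<close>

lemma indep_pairs_in_problem:
  assumes [measurable]: "h \<in> borel_measurable (borel \<Otimes>\<^sub>M borel)"
  shows "indep_vars (\<lambda>_. borel) (\<lambda>j \<omega>. h (X i j \<omega>, \<xi> i j \<omega>)) {..<n}"
proof -
  let ?V = "\<lambda>(i, j) \<omega>. (X i j \<omega>, \<xi> i j \<omega>)"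
  have "indep_vars (\<lambda>j. PiM {(i, j)} (\<lambda>_. borel \<Otimes>\<^sub>M borel))
      (\<lambda>j \<omega>. restrict (\<lambda>p. ?V p \<omega>) {(i, j)}) {..<n}"
    by (rule indep_vars_restrict[OF pairs_indep]) (auto simp: disjoint_family_on_def)
  then have "indep_vars (\<lambda>_. borel)
      (\<lambda>j \<omega>. h (restrict (\<lambda>p. ?V p \<omega>) {(i, j)} (i, j))) {..<n}"
    by (rule indep_vars_compose2) measurable
  then show ?thesis by simp
qed

text \<open>
  For every \<open>U\<close> between \<open>A\<close> and \<open>A'\<close> the sum over \<open>U\<close> is at least the sum over \<open>A\<close> minus the number of
  observations in \<open>A' - A\<close>, since \<open>g \<ge> -1\<close>.  This lower bound does not depend on \<open>U\<close> and is a sum of independent terms, so the exponential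
  Markov inequality controls all \<open>U\<close> at once.  The set \<open>B\<close> is there because the event itself, a union over
  uncountably many \<open>U\<close>, need not be measurable.
\<close>

lemma sandwiched_sum_bound:
  assumes [measurable]: "A \<in> sets borel" "A' \<in> sets borel" "g \<in> borel_measurable borel"
    and bound: "\<And>e. \<bar>g e\<bar> \<le> 1" and "A \<subseteq> A'" and l: "0 < l"
  shows "\<exists>B\<in>events.
     {\<omega> \<in> space M. \<exists>U. A \<subseteq> U \<and> U \<subseteq> A' \<and> (\<Sum>j | j < n \<and> X i j \<omega> \<in> U. g (\<xi> i j \<omega>)) \<le> 0} \<subseteq> B \<and>
     prob B \<le> exp (- (1 - (\<integral>e. exp (- l * g e) \<partial>N)) * (real n * measure X_law A)
                   + (exp l - 1) * (real n * measure X_law (A' - A)))"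
proof -
  define \<rho> where "\<rho> = (\<integral>e. exp (- l * g e) \<partial>N)"
  define h :: "real \<times> real \<Rightarrow> real" where
    "h = (\<lambda>(x, e). exp (- l * (if x \<in> A then g e else if x \<in> A' then - 1 else 0)))"
  have [measurable]: "h \<in> borel_measurable (borel \<Otimes>\<^sub>M borel)"
    unfolding h_def by measurable
  define H where "H j \<omega> = h (X i j \<omega>, \<xi> i j \<omega>)" for j \<omega>
  define B where "B = {\<omega> \<in> space M. 1 \<le> (\<Prod>j<n. H j \<omega>)}"
  have [measurable]: "H j \<in> borel_measurable M" for j unfolding H_def by measurable
  have "B \<in> events" unfolding B_def by measurable
  moreover have
    "{\<omega> \<in> space M. \<exists>U. A \<subseteq> U \<and> U \<subseteq> A' \<and> (\<Sum>j | j < n \<and> X i j \<omega> \<in> U. g (\<xi> i j \<omega>)) \<le> 0} \<subseteq> B"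
  proof safe
    fix \<omega> U assume \<omega>: "\<omega> \<in> space M" and U: "A \<subseteq> U" "U \<subseteq> A'"
      and le: "(\<Sum>j | j < n \<and> X i j \<omega> \<in> U. g (\<xi> i j \<omega>)) \<le> 0"
    let ?k = "\<lambda>j. if X i j \<omega> \<in> A then g (\<xi> i j \<omega>) else if X i j \<omega> \<in> A' then - 1 else 0"
    have "(\<Sum>j<n. ?k j) \<le> (\<Sum>j<n. if X i j \<omega> \<in> U then g (\<xi> i j \<omega>) else 0)"
    proof (rule sum_mono)
      fix j
      show "?k j \<le> (if X i j \<omega> \<in> U then g (\<xi> i j \<omega>) else 0)"
        using U bound[of "\<xi> i j \<omega>"] by auto
    qed
    also have "\<dots> \<le> 0"
      using le sum.inter_filter[of "{..<n}" "\<lambda>j. g (\<xi> i j \<omega>)" "\<lambda>j. X i j \<omega> \<in> U"] by simp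
    finally have "0 \<le> - l * (\<Sum>j<n. ?k j)" using l by (simp add: mult_nonneg_nonpos)
    then have "1 \<le> exp (- l * (\<Sum>j<n. ?k j))" by simp
    also have "\<dots> = (\<Prod>j<n. H j \<omega>)"
      by (simp add: H_def h_def exp_sum sum_distrib_left del: mult_minus_left)
    finally show "\<omega> \<in> B" using \<omega> by (simp add: B_def)
  qed
  moreover have "prob B \<le> exp (- (1 - \<rho>) * (real n * measure X_law A) + (exp l - 1) * (real n * measure X_law (A' - A)))"
  proof -
    have exp_bound: "\<bar>exp (- l * g e) - 1\<bar> \<le> exp l + 1" for e
    proof -
      have "- l * g e \<le> l" using bound[of e] l mult_left_mono[of "- g e" 1 l] by (simp add: abs_le_iff)
      then have "exp (- l * g e) \<le> exp l" by simp
      then show ?thesis using exp_gt_zero[of "- l * g e"] exp_gt_zero[of l]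
        unfolding abs_le_iff by linarith
    qed
    have H_eq: "H j \<omega> = 1 + indicator A (X i j \<omega>) * (exp (- l * g (\<xi> i j \<omega>)) - 1)
        + indicator (A' - A) (X i j \<omega>) * (exp l - 1)" for j \<omega>
      using \<open>A \<subseteq> A'\<close> by (auto simp: H_def h_def indicator_def)
    note i1 = integral_indicator_times_noise[where A = A and g = "\<lambda>e. exp (- l * g e) - 1",
        OF _ _ exp_bound]
    note i2 = integral_indicator_times_noise[where A = "A' - A" and g = "\<lambda>e. exp l - 1" and B = "\<bar>exp l - 1\<bar>"]
    have int_H: "integrable M (H j)" for j
      unfolding H_eq[abs_def] using i1(2)[of i j] i2(2)[of i j] by auto
    have int_g: "integrable N (\<lambda>e. exp (- l * g e))"
    proof (rule N.integrable_const_bound[where B = "exp l"])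
      show "AE e in N. norm (exp (- l * g e)) \<le> exp l"
        using bound l mult_left_mono[of "- g _" 1 l] by (auto simp: abs_le_iff)
    qed auto
    have EH: "(\<integral>\<omega>. H j \<omega> \<partial>M) = 1 - (1 - \<rho>) * measure X_law A + (exp l - 1) * measure X_law (A' - A)" for j
    proof -
      have "(\<integral>e. exp (- l * g e) - 1 \<partial>N) = \<rho> - 1"
        using int_g N.prob_space by (simp add: \<rho>_def)
      then have v1: "(\<integral>\<omega>. indicator A (X i j \<omega>) * (exp (- l * g (\<xi> i j \<omega>)) - 1) \<partial>M) = measure X_law A * (\<rho> - 1)"
        using i1(1)[of i j] by simp
      have v2: "(\<integral>\<omega>. indicator (A' - A) (X i j \<omega>) * (exp l - 1) \<partial>M) = measure X_law (A' - A) * (exp l - 1)"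
        using i2(1)[of i j] N.prob_space by simp
      have "(\<integral>\<omega>. H j \<omega> \<partial>M) = 1 + measure X_law A * (\<rho> - 1) + measure X_law (A' - A) * (exp l - 1)"
        unfolding H_eq v1[symmetric] v2[symmetric] using i1(2)[of i j] i2(2)[of i j]
        by (subst Bochner_Integration.integral_add | simp add: prob_space)+
      then show ?thesis by (simp add: algebra_simps)
    qed
    have H_pos: "0 \<le> H j \<omega>" for j \<omega> by (simp add: H_def h_def split: prod.split)
    have indep_H: "indep_vars (\<lambda>_. borel) H {..<n}"
      unfolding H_def[abs_def] by (rule indep_pairs_in_problem) measurable
    have "prob B \<le> (\<integral>\<omega>. (\<Prod>j<n. H j \<omega>) \<partial>M) / 1"
      unfolding B_def using int_H H_pos
      by (intro integral_Markov_inequality_measure[where A = "{}"] indep_vars_integrable indep_H)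
         (auto intro!: prod_nonneg)
    also have "\<dots> = (\<Prod>j<n. (\<integral>\<omega>. H j \<omega> \<partial>M))"
      using int_H by (simp add: indep_vars_lebesgue_integral[OF _ indep_H])
    also have "\<dots> = (1 - (1 - \<rho>) * measure X_law A + (exp l - 1) * measure X_law (A' - A)) ^ n"
      by (simp add: EH)
    also have "\<dots> \<le> exp (- (1 - \<rho>) * measure X_law A + (exp l - 1) * measure X_law (A' - A)) ^ n"
    proof (rule power_mono)
      let ?y = "- (1 - \<rho>) * measure X_law A + (exp l - 1) * measure X_law (A' - A)"
      show "1 - (1 - \<rho>) * measure X_law A + (exp l - 1) * measure X_law (A' - A) \<le> exp ?y"
        using exp_ge_add_one_self[of ?y] by (simp only: mult_minus_left)
      show "0 \<le> 1 - (1 - \<rho>) * measure X_law A + (exp l - 1) * measure X_law (A' - A)"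
        using H_pos unfolding EH[of 0, symmetric] by (intro integral_nonneg_AE) auto
    qed
    also have "\<dots> = exp (- (1 - \<rho>) * (real n * measure X_law A) + (exp l - 1) * (real n * measure X_law (A' - A)))"
      unfolding exp_of_nat_mult[symmetric] by (simp add: algebra_simps)
    finally show ?thesis .
  qed
  ultimately show ?thesis unfolding \<rho>_def by blast
qed


text \<open>
  A grid \<open>A 0 \<subseteq> A 1 \<subseteq> \<dots> \<subseteq> A L\<close> in the chain with steps of probability \<open>1 / n\<close> places every \<open>U\<close> of the chain
  between two neighbours, and the bounds for the gaps form a geometric series.  Measuring the grid in
  probability rather than in length treats the neighbourhood of the change point and the far tails alike.
\<close>

lemma chain_sum_bound:
  assumes [measurable]: "g \<in> borel_measurable borel" and bound: "\<And>e. \<bar>g e\<bar> \<le> 1" and l: "0 < l"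
    and \<rho>: "\<rho> = (\<integral>e. exp (- l * g e) \<partial>N)" "\<rho> < 1" and n: "0 < n"
    and chain: "\<And>U V. U \<in> F \<Longrightarrow> V \<in> F \<Longrightarrow> U \<subseteq> V \<or> V \<subseteq> U"
    and borel: "F \<subseteq> sets borel"
    and S: "S \<in> F" "\<And>U. U \<in> F \<Longrightarrow> S \<subseteq> U"
    and T: "T \<in> F" "\<And>U. U \<in> F \<Longrightarrow> U \<subseteq> T"
    and no_gap: "\<And>q. measure X_law S \<le> q \<Longrightarrow> q \<le> measure X_law T \<Longrightarrow> \<exists>U\<in>F. measure X_law U = q"
  shows "\<exists>B\<in>events.
     {\<omega> \<in> space M. \<exists>U\<in>F. (\<Sum>j | j < n \<and> X i j \<omega> \<in> U. g (\<xi> i j \<omega>)) \<le> 0} \<subseteq> B \<and>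
     prob B \<le> exp (exp l - 1) / (1 - exp (- (1 - \<rho>))) * exp (- (1 - \<rho>) * (real n * measure X_law S))"
proof -
  define p where "p = measure X_law S"
  \<comment> \<open>the last grid set is \<open>T\<close> itself; rounding down keeps all earlier levels at most \<open>measure X_law T\<close>\<close>
  define L where "L = Suc (nat \<lfloor>real n * (measure X_law T - p)\<rfloor>)"
  define A where "A k = (if k = 0 then S else if k < L then
      (SOME U. U \<in> F \<and> measure X_law U = p + real k / real n) else T)" for k
  have pT: "p \<le> measure X_law T"
    unfolding p_def using S T borel by (intro X_law.finite_measure_mono) auto
  have level: "p + real k / real n \<le> measure X_law T" if "k < L" for k
  proof -
    have "real k \<le> real (nat \<lfloor>real n * (measure X_law T - p)\<rfloor>)" using that by (simp add: L_def)
    also have "\<dots> \<le> real n * (measure X_law T - p)"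
      using pT by (intro of_nat_floor) auto
    finally show ?thesis using n by (simp add: field_simps)
  qed
  have A: "A k \<in> F" "k < L \<Longrightarrow> measure X_law (A k) = p + real k / real n" for k
  proof -
    have ex: "\<exists>U. U \<in> F \<and> measure X_law U = p + real k / real n" if "k < L"
      using no_gap[of "p + real k / real n"] level[OF that] by (auto simp: p_def)
    show "A k \<in> F" using S(1) T(1) someI_ex[OF ex] by (auto simp: A_def)
    show "measure X_law (A k) = p + real k / real n" if "k < L"
      using someI_ex[OF ex] that by (auto simp: A_def p_def)
  qed
  have A_borel [measurable]: "A k \<in> sets borel" for k using A(1) borel by auto
  have AL: "A L = T" by (simp add: A_def L_def)
  have inc: "A k \<subseteq> A (Suc k)" if "k < L" for k
  proof (cases "Suc k = L")
    case True
    then show ?thesis using T(2)[OF A(1)[of k]] AL by simp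
  next
    case False
    then have "Suc k < L" using that by simp
    then have "measure X_law (A k) < measure X_law (A (Suc k))"
      using A(2)[of k] A(2)[of "Suc k"] n by (simp add: divide_strict_right_mono)
    then have "\<not> A (Suc k) \<subseteq> A k"
      using X_law.finite_measure_mono[of "A (Suc k)" "A k"] by auto
    then show ?thesis using chain[OF A(1)[of k] A(1)[of "Suc k"]] by auto
  qed
  have gap: "real n * measure X_law (A (Suc k) - A k) \<le> 1" if "k < L" for k
  proof -
    have "measure X_law (A (Suc k)) \<le> p + real (Suc k) / real n"
    proof (cases "Suc k = L")
      case True
      have "real n * (measure X_law T - p) \<le> real L" unfolding L_def by linarith
      then show ?thesis using True AL n by (simp add: field_simps)
    next
      case False
      then show ?thesis using that A(2)[of "Suc k"] by simp
    qed
    moreover have "measure X_law (A (Suc k) - A k) = measure X_law (A (Suc k)) - measure X_law (A k)"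
      using inc[OF that] by (intro X_law.finite_measure_Diff) auto
    ultimately have "measure X_law (A (Suc k) - A k) \<le> 1 / real n"
      using A(2)[OF that] by (simp add: add_divide_distrib)
    then show ?thesis using n by (simp add: field_simps)
  qed
  let ?W = "\<lambda>k. {\<omega> \<in> space M. \<exists>U. A k \<subseteq> U \<and> U \<subseteq> A (Suc k)
      \<and> (\<Sum>j | j < n \<and> X i j \<omega> \<in> U. g (\<xi> i j \<omega>)) \<le> 0}"
  let ?c = "exp (exp l - 1) * exp (- (1 - \<rho>) * (real n * p))"
  have "\<exists>B\<in>events. ?W k \<subseteq> B \<and> prob B \<le> ?c * exp (- (1 - \<rho>)) ^ k" if kL: "k < L" for k
  proof -
    obtain B where B: "B \<in> events" "?W k \<subseteq> B" "prob B \<le> exp (- (1 - \<rho>) * (real n * measure X_law (A k))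
                   + (exp l - 1) * (real n * measure X_law (A (Suc k) - A k)))"
      using sandwiched_sum_bound[OF A_borel[of k] A_borel[of "Suc k"] assms(1) bound inc[OF kL] l, of i n]
      unfolding \<rho>(1) by auto
    note B(3)
    also have "\<dots> \<le> exp (- (1 - \<rho>) * (real n * p + real k) + (exp l - 1) * 1)"
    proof -
      have "real n * measure X_law (A k) = real n * p + real k"
        using A(2)[OF kL] n by (simp add: field_simps)
      then show ?thesis using gap[OF kL] l by (auto intro!: mult_left_le)
    qed
    also have "\<dots> = ?c * exp (- (1 - \<rho>)) ^ k"
      by (simp add: exp_of_nat_mult[symmetric] exp_add[symmetric] algebra_simps)
    finally show ?thesis using B(1,2) by blast
  qed
  then have "\<forall>k\<in>{..<L}. \<exists>B. B \<in> events \<and> ?W k \<subseteq> B \<and> prob B \<le> ?c * exp (- (1 - \<rho>)) ^ k"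
    by blast
  from bchoice[OF this] obtain B where
    "\<forall>k\<in>{..<L}. B k \<in> events \<and> ?W k \<subseteq> B k \<and> prob (B k) \<le> ?c * exp (- (1 - \<rho>)) ^ k" ..
  then have B: "\<And>k. k < L \<Longrightarrow> B k \<in> events" "\<And>k. k < L \<Longrightarrow> ?W k \<subseteq> B k"
      "\<And>k. k < L \<Longrightarrow> prob (B k) \<le> ?c * exp (- (1 - \<rho>)) ^ k"
    unfolding Ball_def lessThan_iff by blast+
  have "{\<omega> \<in> space M. \<exists>U\<in>F. (\<Sum>j | j < n \<and> X i j \<omega> \<in> U. g (\<xi> i j \<omega>)) \<le> 0} \<subseteq> (\<Union>k<L. B k)"
  proof safe
    fix \<omega> U assume \<omega>: "\<omega> \<in> space M" and U: "U \<in> F"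
      and le: "(\<Sum>j | j < n \<and> X i j \<omega> \<in> U. g (\<xi> i j \<omega>)) \<le> 0"
    have fin: "finite {k. k < L \<and> A k \<subseteq> U}" by simp
    have "0 \<in> {k. k < L \<and> A k \<subseteq> U}" using S(2)[OF U] by (simp add: A_def L_def)
    define k where "k = Max {k. k < L \<and> A k \<subseteq> U}"
    have k: "k < L" "A k \<subseteq> U"
      using Max_in[OF fin] \<open>0 \<in> _\<close> unfolding k_def by blast+
    have "U \<subseteq> A (Suc k)"
    proof (rule ccontr)
      assume "\<not> U \<subseteq> A (Suc k)"
      then have "A (Suc k) \<subseteq> U" "Suc k \<noteq> L"
        using chain[OF U A(1)[of "Suc k"]] T(2)[OF U] AL by auto
      then have "Suc k \<in> {k. k < L \<and> A k \<subseteq> U}" using k by auto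
      from Max_ge[OF fin this, folded k_def] show False by simp
    qed
    with k \<omega> le have "\<omega> \<in> ?W k" by blast
    with B(2) k(1) show "\<omega> \<in> (\<Union>k<L. B k)" by blast
  qed
  moreover have "prob (\<Union>k<L. B k) \<le> exp (exp l - 1) / (1 - exp (- (1 - \<rho>))) * exp (- (1 - \<rho>) * (real n * p))"
  proof -
    have "prob (\<Union>k<L. B k) \<le> (\<Sum>k<L. prob (B k))"
      using B(1) by (intro finite_measure_subadditive_finite) auto
    also have "\<dots> \<le> (\<Sum>k<L. ?c * exp (- (1 - \<rho>)) ^ k)" using B(3) by (intro sum_mono) auto
    also have "\<dots> = ?c * (\<Sum>k<L. exp (- (1 - \<rho>)) ^ k)" by (simp add: sum_distrib_left)
    also have "\<dots> \<le> ?c * (1 / (1 - exp (- (1 - \<rho>))))"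
    proof (rule mult_left_mono)
      have r: "exp (- (1 - \<rho>)) < 1" using \<rho>(2) by simp
      then show "(\<Sum>k<L. exp (- (1 - \<rho>)) ^ k) \<le> 1 / (1 - exp (- (1 - \<rho>)))"
        using sum_le_suminf[of "\<lambda>k. exp (- (1 - \<rho>)) ^ k" "{..<L}"]
          suminf_geometric[of "exp (- (1 - \<rho>))"] by (simp add: summable_geometric)
    qed simp
    finally show ?thesis by simp
  qed
  moreover have "(\<Union>k<L. B k) \<in> events" using B(1) by auto
  ultimately show ?thesis unfolding p_def by blast
qed

end

section \<open>Symmetric noise with a power tail\<close>

locale symmetric_power_tail = prob_space N for N :: "real measure" +
  fixes \<gamma> :: real
  assumes sets_N: "sets N = sets borel"
    and tail_index: "0 < \<gamma>"
    and reflect: "distr N borel uminus = N"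
    and tail: "\<And>t. 0 \<le> t \<Longrightarrow> measure N {e. t \<le> \<bar>e\<bar>} = 1 / (1 + t powr \<gamma>)"
begin

declare sets_N [simp, measurable_cong]

lemma space_N [simp]: "space N = UNIV"
  using sets_eq_imp_space_eq[OF sets_N] by simp

lemma integral_reflect:
  fixes g :: "real \<Rightarrow> real"
  assumes [measurable]: "g \<in> borel_measurable borel"
  shows "(\<integral>e. g (- e) \<partial>N) = (\<integral>e. g e \<partial>N)"
  by (subst (2) reflect[symmetric]) (simp add: integral_distr)

lemma lower_tail:
  assumes "0 < t"
  shows "measure N {..-t} = 1 / (2 * (1 + t powr \<gamma>))"
proof -
  have "measure N {t..} = measure (distr N borel uminus) {t..}" by (simp add: reflect)
  also have "\<dots> = measure N {..-t}"
    by (subst measure_distr) (auto intro!: arg_cong[where f = "measure N"] simp: le_minus_iff)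
  finally have "measure N {t..} = measure N {..-t}" .
  moreover have "{e. t \<le> \<bar>e\<bar>} = {..-t} \<union> {t..}" by auto
  moreover have "measure N ({..-t} \<union> {t..}) = measure N {..-t} + measure N {t..}"
    using assms by (intro finite_measure_Union) auto
  moreover define u where "u = 1 + t powr \<gamma>"
  ultimately have "2 * measure N {..-t} = 1 / u"
    using tail[of t] assms by simp
  then have "measure N {..-t} = 1 / (2 * u)" by simp
  then show ?thesis by (simp add: u_def)
qed

lemma upper_tail: "measure N {1..} = 1 / 4"
proof -
  have "measure N {1..} = measure (distr N borel uminus) {1..}" by (simp add: reflect)
  also have "\<dots> = measure N {..-1}"
    by (subst measure_distr) (auto intro!: arg_cong[where f = "measure N"] simp: le_minus_iff)
  finally show ?thesis using lower_tail[of 1] by simp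
qed

text \<open>
  The change of the absolute loss when an observation to the right of the change point is put on the
  wrong side.
\<close>

definition \<phi> :: "real \<Rightarrow> real" where "\<phi> e = \<bar>e + 1\<bar> - \<bar>e\<bar>"

lemma \<phi>_measurable [measurable]: "\<phi> \<in> borel_measurable borel"
  unfolding \<phi>_def[abs_def] by measurable

lemma \<phi>_bound: "\<bar>\<phi> e\<bar> \<le> 1"
  by (auto simp: \<phi>_def)

lemma integrable_\<phi>: "integrable N \<phi>" "integrable N (\<lambda>e. \<phi> (- e))" "integrable N (\<lambda>e. (\<phi> e)\<^sup>2)"
  using \<phi>_bound by (auto intro!: integrable_const_bound[where B = 1] simp: abs_square_le_1)

text \<open>
  By symmetry the mean is half that of \<open>\<phi> e + \<phi> (- e) = 2 max 0 (1 - |e|)\<close>.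
\<close>

lemma \<phi>_mean_pos: "0 < (\<integral>e. \<phi> e \<partial>N)"
proof -
  have "{e :: real. \<bar>e\<bar> < 1/2} = UNIV - {e. 1/2 \<le> \<bar>e\<bar>}" by auto
  then have "measure N {e. \<bar>e\<bar> < 1/2} = 1 - 1 / (1 + (1/2) powr \<gamma>)"
    using tail[of "1/2"] prob_compl[of "{e. 1/2 \<le> \<bar>e\<bar>}"] by simp
  moreover have "1 / (1 + (1/2) powr \<gamma>) < 1" by (simp add: divide_less_eq add_pos_nonneg)
  ultimately have "0 < measure N {e. \<bar>e\<bar> < 1/2}" by simp
  also have "\<dots> = (\<integral>e. indicator {e. \<bar>e\<bar> < 1/2} e \<partial>N)" by simp
  also have "\<dots> \<le> (\<integral>e. \<phi> e + \<phi> (- e) \<partial>N)"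
  proof (rule integral_mono)
    fix e :: real
    have "\<bar>2 * e\<bar> \<le> \<bar>e + 1\<bar> + \<bar>1 - e\<bar>" using abs_triangle_ineq4[of "e + 1" "1 - e"] by simp
    moreover have "2 \<le> \<bar>e + 1\<bar> + \<bar>1 - e\<bar>" by linarith
    ultimately show "indicator {e. \<bar>e\<bar> < 1/2} e \<le> \<phi> e + \<phi> (- e)"
      by (simp add: indicator_def \<phi>_def add.commute abs_mult)
  next
    show "integrable N (\<lambda>e. indicator {e. \<bar>e\<bar> < 1/2} e :: real)"
      by (rule integrable_const_bound[where B = 1]) (auto simp: indicator_def)
    show "integrable N (\<lambda>e. \<phi> e + \<phi> (- e))" using integrable_\<phi> by simp
  qed
  also have "\<dots> = 2 * (\<integral>e. \<phi> e \<partial>N)"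
    using integrable_\<phi> integral_reflect[of \<phi>] by simp
  finally show ?thesis by simp
qed

lemma \<phi>_mean_le_1: "(\<integral>e. \<phi> e \<partial>N) \<le> 1"
proof -
  have "(\<integral>e. \<phi> e \<partial>N) \<le> (\<integral>e. 1 \<partial>N)"
    using integrable_\<phi>(1) \<phi>_bound by (intro integral_mono) (auto simp: abs_le_iff)
  then show ?thesis using prob_space by simp
qed

lemma esssup_eq_attained:
  fixes Z :: "real \<Rightarrow> real"
  assumes [measurable]: "Z \<in> borel_measurable borel" "A \<in> sets borel"
    and le: "\<And>e. Z e \<le> v" and eq: "\<And>e. e \<in> A \<Longrightarrow> Z e = v" and pos: "0 < measure N A"
  shows "esssup N (\<lambda>e. ereal (Z e)) = ereal v"
proof (rule antisym)
  show "esssup N (\<lambda>e. ereal (Z e)) \<le> ereal v"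
    using le by (intro esssup_I) auto
  show "ereal v \<le> esssup N (\<lambda>e. ereal (Z e))"
  proof (rule ccontr)
    assume "\<not> ?thesis"
    then have "AE e in N. e \<notin> A"
      using esssup_AE[of "\<lambda>e. ereal (Z e)" N] eq by (auto elim!: eventually_mono)
    then have "measure N A = 0"
      by (subst (asm) AE_iff_measurable[of A]) (auto simp: measure_def)
    then show False using pos by simp
  qed
qed

text \<open>
  The extreme values \<open>\<plusminus>1\<close> of \<open>\<phi>\<close> are taken on half-lines of positive probability.
\<close>

lemma range_\<phi>: "essential_range_length N (\<lambda>e. \<phi> e - \<mu>) = 2"
proof -
  have "esssup N (\<lambda>e. ereal (\<phi> e - \<mu>)) = ereal (1 - \<mu>)"
    using \<phi>_bound upper_tail
    by (intro esssup_eq_attained[where A = "{1..}"]) (auto simp: abs_le_iff, simp add: \<phi>_def)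
  moreover have "esssup N (\<lambda>e. ereal (- (\<phi> e - \<mu>))) = ereal (1 + \<mu>)"
    using \<phi>_bound lower_tail[of 1]
    by (intro esssup_eq_attained[where A = "{..-1}"])
       (auto simp: abs_le_iff minus_le_iff, simp add: \<phi>_def)
  ultimately show ?thesis by (simp add: essential_range_length_def)
qed

lemma exp_le_quadratic: "exp y \<le> 1 + y + y\<^sup>2" if "\<bar>y\<bar> \<le> 1" for y :: real
proof (cases "0 \<le> y")
  case True
  then show ?thesis using that exp_bound[of y] by simp
next
  case False
  have "1 \<le> (1 - y) * (1 + y + y\<^sup>2)"
  proof -
    have "(1 - y) * (1 + y + y\<^sup>2) = 1 - y ^ 3" by (simp add: algebra_simps power2_eq_square power3_eq_cube)
    moreover have "y ^ 3 \<le> 0" using False by (simp add: power_le_zero_eq)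
    ultimately show ?thesis by simp
  qed
  moreover have "0 < 1 + y + y\<^sup>2"
  proof -
    have "1 + y + y\<^sup>2 = (y + 1/2)\<^sup>2 + 3/4" by (simp add: power2_eq_square algebra_simps)
    then show ?thesis by (simp add: add_nonneg_pos)
  qed
  moreover have "1 - y \<le> exp (- y)" using exp_ge_add_one_self[of "- y"] by simp
  ultimately have "1 \<le> exp (- y) * (1 + y + y\<^sup>2)"
    using mult_right_mono[of "1 - y" "exp (- y)" "1 + y + y\<^sup>2"] by linarith
  then have "exp y * 1 \<le> exp y * (exp (- y) * (1 + y + y\<^sup>2))"
    by (intro mult_left_mono) auto
  then show ?thesis by (simp add: mult.assoc[symmetric] exp_minus_inverse)
qed

text \<open>
  A quadratic expansion of the exponential replaces Hoeffding's lemma: it loses only a constant in the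
  exponent, while the bound that is needed, \<open>exp (- \<mu>\<^sup>2 / 16)\<close>, leaves a factor 4.
\<close>

lemma \<phi>_laplace:
  defines "\<mu> \<equiv> \<integral>e. \<phi> e \<partial>N"
  shows "(\<integral>e. exp (- (\<mu> / 2) * \<phi> e) \<partial>N) \<le> exp (- (\<mu>\<^sup>2 / 4))"
proof -
  have \<mu>: "0 < \<mu>" "\<mu> \<le> 1" using \<phi>_mean_pos \<phi>_mean_le_1 by (auto simp: \<mu>_def)
  have small: "\<bar>- (\<mu> / 2) * \<phi> e\<bar> \<le> 1" for e
    using \<mu> \<phi>_bound[of e] mult_mono[of "\<mu> / 2" 1 "\<bar>\<phi> e\<bar>" 1] by (simp add: abs_mult)
  have "(\<integral>e. exp (- (\<mu> / 2) * \<phi> e) \<partial>N) \<le> (\<integral>e. 1 - \<mu> / 2 * \<phi> e + (\<mu> / 2)\<^sup>2 * (\<phi> e)\<^sup>2 \<partial>N)"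
  proof (rule integral_mono)
    show "integrable N (\<lambda>e. exp (- (\<mu> / 2) * \<phi> e))"
    proof (rule integrable_const_bound[where B = "exp 1"])
      have "norm (exp (- (\<mu> / 2) * \<phi> e)) \<le> exp 1" for e
        using small[of e] by (simp add: abs_le_iff)
      then show "AE e in N. norm (exp (- (\<mu> / 2) * \<phi> e)) \<le> exp 1" by simp
    qed auto
    show "integrable N (\<lambda>e. 1 - \<mu> / 2 * \<phi> e + (\<mu> / 2)\<^sup>2 * (\<phi> e)\<^sup>2)"
      using integrable_\<phi> by auto
    show "exp (- (\<mu> / 2) * \<phi> e) \<le> 1 - \<mu> / 2 * \<phi> e + (\<mu> / 2)\<^sup>2 * (\<phi> e)\<^sup>2" for e
      using exp_le_quadratic[OF small[of e]] by (simp add: power_mult_distrib power_divide)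
  qed
  also have "\<dots> = 1 - \<mu> / 2 * \<mu> + (\<mu> / 2)\<^sup>2 * (\<integral>e. (\<phi> e)\<^sup>2 \<partial>N)"
    using integrable_\<phi> prob_space by (simp add: \<mu>_def)
  also have "\<dots> \<le> 1 - \<mu> / 2 * \<mu> + (\<mu> / 2)\<^sup>2 * 1"
  proof -
    have "(\<integral>e. (\<phi> e)\<^sup>2 \<partial>N) \<le> (\<integral>e. 1 \<partial>N)"
      using integrable_\<phi> \<phi>_bound by (intro integral_mono) (auto simp: abs_square_le_1)
    then show ?thesis using prob_space by (intro add_left_mono mult_left_mono) auto
  qed
  also have "\<dots> = 1 + - (\<mu>\<^sup>2 / 4)" by (simp add: power2_eq_square)
  also have "\<dots> \<le> exp (- (\<mu>\<^sup>2 / 4))" by (rule exp_ge_add_one_self)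
  finally show ?thesis .
qed

end

section \<open>The absolute loss\<close>

context change_point_problems
begin

text \<open>
  The intervals \<open>{z<..d}\<close> together with \<open>{z<..}\<close> form a chain, and continuity of the distribution function
  makes their probabilities fill an interval.
\<close>

lemma right_exit_bound:
  assumes g: "g \<in> borel_measurable borel" "\<And>e. \<bar>g e\<bar> \<le> 1" and l: "0 < l"
    and \<rho>: "\<rho> = (\<integral>e. exp (- l * g e) \<partial>N)" "\<rho> < 1" and n: "0 < n" and s: "0 < s"
  shows "\<exists>B\<in>events.
     {\<omega> \<in> space M. \<exists>d>z + s. (\<Sum>j | j < n \<and> X i j \<omega> \<in> {z<..d}. g (\<xi> i j \<omega>)) \<le> 0} \<subseteq> B \<and>
     prob B \<le> exp (exp l - 1) / (1 - exp (- (1 - \<rho>))) * exp (- (1 - \<rho>) * (real n * measure X_law {z<..z + s}))"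
proof -
  define F where "F = insert {z<..} ((\<lambda>d. {z<..d}) ` {z + s..})"
  have total: "cdf X_law z + measure X_law {z<..} = 1"
  proof -
    have "UNIV - {..z} = {z<..}" by auto
    then show ?thesis using X_law.prob_compl[of "{..z}"] by (simp add: cdf_def)
  qed
  have "\<exists>U\<in>F. measure X_law U = q" if q: "measure X_law {z<..z + s} \<le> q" "q \<le> measure X_law {z<..}" for q
  proof (cases "q = measure X_law {z<..}")
    case True
    then show ?thesis by (auto simp: F_def)
  next
    case False
    then have "cdf X_law z + q < 1" using total q by simp
    then have "\<forall>\<^sub>F b in at_top. cdf X_law z + q < cdf X_law b"
      by (rule order_tendstoD(1)[OF X_law.cdf_lim_at_top_prob])
    then obtain b where b: "z + s \<le> b" "cdf X_law z + q < cdf X_law b"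
      using eventually_happens[OF eventually_conj[OF eventually_ge_at_top[of "z + s"]]] by auto
    have "cdf X_law (z + s) - cdf X_law z \<le> q" using q(1) s by (subst X_law.cdf_diff_eq) auto
    then obtain v where v: "z + s \<le> v" "cdf X_law v = cdf X_law z + q"
      using IVT'[of "cdf X_law" "z + s" "cdf X_law z + q" b] b isCont_cdf_X_law
      by (force simp: continuous_on_eq_continuous_within continuous_at_imp_continuous_at_within)
    then have "measure X_law {z<..v} = q" using s by (subst X_law.cdf_diff_eq[symmetric]) auto
    then show ?thesis using v by (auto simp: F_def)
  qed
  then obtain B where B: "B \<in> events"
    "{\<omega> \<in> space M. \<exists>U\<in>F. (\<Sum>j | j < n \<and> X i j \<omega> \<in> U. g (\<xi> i j \<omega>)) \<le> 0} \<subseteq> B"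
    "prob B \<le> exp (exp l - 1) / (1 - exp (- (1 - \<rho>))) * exp (- (1 - \<rho>) * (real n * measure X_law {z<..z + s}))"
    using chain_sum_bound[OF g l \<rho> n, of F "{z<..z + s}" "{z<..}" i] by (force simp: F_def)
  have "{\<omega> \<in> space M. \<exists>d>z + s. (\<Sum>j | j < n \<and> X i j \<omega> \<in> {z<..d}. g (\<xi> i j \<omega>)) \<le> 0}
      \<subseteq> {\<omega> \<in> space M. \<exists>U\<in>F. (\<Sum>j | j < n \<and> X i j \<omega> \<in> U. g (\<xi> i j \<omega>)) \<le> 0}"
  proof safe
    fix \<omega> d assume "z + s < d" "(\<Sum>j | j < n \<and> X i j \<omega> \<in> {z<..d}. g (\<xi> i j \<omega>)) \<le> 0"
    then show "\<exists>U\<in>F. (\<Sum>j | j < n \<and> X i j \<omega> \<in> U. g (\<xi> i j \<omega>)) \<le> 0"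
      by (intro bexI[where x = "{z<..d}"]) (auto simp: F_def)
  qed
  also note B(2)
  finally show ?thesis using B(1,3) by blast
qed

lemma left_exit_bound:
  assumes g: "g \<in> borel_measurable borel" "\<And>e. \<bar>g e\<bar> \<le> 1" and l: "0 < l"
    and \<rho>: "\<rho> = (\<integral>e. exp (- l * g e) \<partial>N)" "\<rho> < 1" and n: "0 < n" and s: "0 < s"
  shows "\<exists>B\<in>events.
     {\<omega> \<in> space M. \<exists>d<z - s. (\<Sum>j | j < n \<and> X i j \<omega> \<in> {d<..z}. g (\<xi> i j \<omega>)) \<le> 0} \<subseteq> B \<and>
     prob B \<le> exp (exp l - 1) / (1 - exp (- (1 - \<rho>))) * exp (- (1 - \<rho>) * (real n * measure X_law {z - s<..z}))"
proof -
  define F where "F = insert {..z} ((\<lambda>d. {d<..z}) ` {..z - s})"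
  have "\<exists>U\<in>F. measure X_law U = q" if q: "measure X_law {z - s<..z} \<le> q" "q \<le> measure X_law {..z}" for q
  proof (cases "q = measure X_law {..z}")
    case True
    then show ?thesis by (auto simp: F_def)
  next
    case False
    then have "0 < cdf X_law z - q" using q by (simp add: cdf_def)
    then have "\<forall>\<^sub>F b in at_bot. cdf X_law b < cdf X_law z - q"
      by (rule order_tendstoD(2)[OF X_law.cdf_lim_at_bot])
    then obtain b where b: "b \<le> z - s" "cdf X_law b < cdf X_law z - q"
      using eventually_happens[OF eventually_conj[OF eventually_le_at_bot[of "z - s"]]] by auto
    have "cdf X_law z - cdf X_law (z - s) \<le> q" using q(1) s by (subst X_law.cdf_diff_eq) auto
    then obtain v where v: "v \<le> z - s" "cdf X_law v = cdf X_law z - q"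
      using IVT'[of "cdf X_law" b "cdf X_law z - q" "z - s"] b isCont_cdf_X_law
      by (force simp: continuous_on_eq_continuous_within continuous_at_imp_continuous_at_within)
    then have "measure X_law {v<..z} = q" using s by (subst X_law.cdf_diff_eq[symmetric]) auto
    then show ?thesis using v by (auto simp: F_def)
  qed
  then obtain B where B: "B \<in> events"
    "{\<omega> \<in> space M. \<exists>U\<in>F. (\<Sum>j | j < n \<and> X i j \<omega> \<in> U. g (\<xi> i j \<omega>)) \<le> 0} \<subseteq> B"
    "prob B \<le> exp (exp l - 1) / (1 - exp (- (1 - \<rho>))) * exp (- (1 - \<rho>) * (real n * measure X_law {z - s<..z}))"
    using chain_sum_bound[OF g l \<rho> n, of F "{z - s<..z}" "{..z}" i] by (force simp: F_def)
  have "{\<omega> \<in> space M. \<exists>d<z - s. (\<Sum>j | j < n \<and> X i j \<omega> \<in> {d<..z}. g (\<xi> i j \<omega>)) \<le> 0}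
      \<subseteq> {\<omega> \<in> space M. \<exists>U\<in>F. (\<Sum>j | j < n \<and> X i j \<omega> \<in> U. g (\<xi> i j \<omega>)) \<le> 0}"
  proof safe
    fix \<omega> d assume "d < z - s" "(\<Sum>j | j < n \<and> X i j \<omega> \<in> {d<..z}. g (\<xi> i j \<omega>)) \<le> 0"
    then show "\<exists>U\<in>F. (\<Sum>j | j < n \<and> X i j \<omega> \<in> U. g (\<xi> i j \<omega>)) \<le> 0"
      by (intro bexI[where x = "{d<..z}"]) (auto simp: F_def)
  qed
  also note B(2)
  finally show ?thesis using B(1,3) by blast
qed

end

locale power_tail_change_points =
  change_point_problems M f fd0 N d0 X \<xi> + noise: symmetric_power_tail N \<gamma>
  for M :: "'a measure" and f fd0 N d0 X \<xi> \<gamma>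
begin

text \<open>
  An error to the right makes the sum of \<open>\<phi> \<xi>\<close> nonpositive, one to the left the sum of \<open>\<phi> (- \<xi>)\<close>; by symmetry
  both have the same Laplace transform.
\<close>

lemma l1_error_tail:
  assumes l: "0 < l" and \<rho>: "\<rho> = (\<integral>e. exp (- l * noise.\<phi> e) \<partial>N)" "\<rho> < 1" and n: "0 < n" and s: "0 < s"
    and window: "p \<le> measure X_law {d0 i<..d0 i + s}" "p \<le> measure X_law {d0 i - s<..d0 i}"
  shows "\<exists>B\<in>events. {\<omega> \<in> space M. ereal s < \<bar>l1_estimator d0 X \<xi> n i \<omega> - ereal (d0 i)\<bar>} \<subseteq> B \<and>
     prob B \<le> 2 * exp (exp l - 1) / (1 - exp (- (1 - \<rho>))) * exp (- (1 - \<rho>) * (real n * p))"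
proof -
  let ?c = "exp (exp l - 1) / (1 - exp (- (1 - \<rho>)))"
  have c: "0 \<le> ?c" using \<rho>(2) by simp
  have mono: "?c * exp (- (1 - \<rho>) * (real n * q)) \<le> ?c * exp (- (1 - \<rho>) * (real n * p))" if "p \<le> q" for q
    using that \<rho>(2) by (intro mult_left_mono[OF _ c]) (simp add: mult_left_mono)
  let ?R = "{\<omega> \<in> space M. \<exists>d>d0 i + s. (\<Sum>j | j < n \<and> X i j \<omega> \<in> {d0 i<..d}. noise.\<phi> (\<xi> i j \<omega>)) \<le> 0}"
  let ?L = "{\<omega> \<in> space M. \<exists>d<d0 i - s. (\<Sum>j | j < n \<and> X i j \<omega> \<in> {d<..d0 i}. noise.\<phi> (- \<xi> i j \<omega>)) \<le> 0}"
  obtain R where R: "R \<in> events" "?R \<subseteq> R"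
    "prob R \<le> ?c * exp (- (1 - \<rho>) * (real n * measure X_law {d0 i<..d0 i + s}))"
    using right_exit_bound[OF noise.\<phi>_measurable noise.\<phi>_bound l \<rho> n s, of "d0 i" i] by blast
  have "\<rho> = (\<integral>e. exp (- l * noise.\<phi> (- e)) \<partial>N)"
    unfolding \<rho>(1) using noise.integral_reflect[of "\<lambda>e. exp (- l * noise.\<phi> e)"] by simp
  note \<rho>' = this \<rho>(2)
  have \<phi>': "(\<lambda>e. noise.\<phi> (- e)) \<in> borel_measurable borel" by measurable
  obtain L where L: "L \<in> events" "?L \<subseteq> L"
    "prob L \<le> ?c * exp (- (1 - \<rho>) * (real n * measure X_law {d0 i - s<..d0 i}))"
    using left_exit_bound[OF \<phi>' noise.\<phi>_bound l \<rho>' n s, of "d0 i" i] by blast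
  have "{\<omega> \<in> space M. ereal s < \<bar>l1_estimator d0 X \<xi> n i \<omega> - ereal (d0 i)\<bar>} \<subseteq> R \<union> L"
  proof safe
    fix \<omega> assume \<omega>: "\<omega> \<in> space M" "\<omega> \<notin> L"
      and far: "ereal s < \<bar>l1_estimator d0 X \<xi> n i \<omega> - ereal (d0 i)\<bar>"
    from far obtain d where d: "s < \<bar>d - d0 i\<bar>"
      and le: "m_loss abs n (\<lambda>j. X i j \<omega>) (\<lambda>j. response (d0 i) (X i j \<omega>) (\<xi> i j \<omega>)) d
        \<le> m_loss abs n (\<lambda>j. X i j \<omega>) (\<lambda>j. response (d0 i) (X i j \<omega>) (\<xi> i j \<omega>)) (d0 i)"
      unfolding l1_estimator_def l1_loss_eq_m_loss
      by (rule step_criterion.smallest_minimizer_far[OF step_criterion_m_loss _ less_imp_le[OF s]])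
    have "(\<Sum>j | j < n \<and> X i j \<omega> \<in> {d0 i<..d}. noise.\<phi> (\<xi> i j \<omega>))
        + (\<Sum>j | j < n \<and> X i j \<omega> \<in> {d<..d0 i}. noise.\<phi> (- \<xi> i j \<omega>)) \<le> 0"
    proof -
      have "\<bar>e - 1\<bar> - \<bar>e\<bar> = noise.\<phi> (- e)" for e
        unfolding noise.\<phi>_def by (simp add: abs_minus_commute)
      then show ?thesis
        using le m_loss_response_diff[of abs n "\<lambda>j. X i j \<omega>" "d0 i" "\<lambda>j. \<xi> i j \<omega>" d]
        by (simp add: noise.\<phi>_def)
    qed
    moreover have "d + s < d0 i \<or> d0 i + s < d" using d by linarith
    moreover have "{d0 i<..d} = {} \<or> {d<..d0 i} = {}" by auto
    ultimately have "\<omega> \<in> ?R \<or> \<omega> \<in> ?L"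
    proof (elim disjE)
      assume "(\<Sum>j | j < n \<and> X i j \<omega> \<in> {d0 i<..d}. noise.\<phi> (\<xi> i j \<omega>))
        + (\<Sum>j | j < n \<and> X i j \<omega> \<in> {d<..d0 i}. noise.\<phi> (- \<xi> i j \<omega>)) \<le> 0" "d + s < d0 i"
        "{d0 i<..d} = {}"
      then have "d < d0 i - s" "(\<Sum>j | j < n \<and> X i j \<omega> \<in> {d<..d0 i}. noise.\<phi> (- \<xi> i j \<omega>)) \<le> 0"
        by simp_all
      then show ?thesis using \<omega>(1) by blast
    next
      assume "(\<Sum>j | j < n \<and> X i j \<omega> \<in> {d0 i<..d}. noise.\<phi> (\<xi> i j \<omega>))
        + (\<Sum>j | j < n \<and> X i j \<omega> \<in> {d<..d0 i}. noise.\<phi> (- \<xi> i j \<omega>)) \<le> 0" "d0 i + s < d"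
        "{d<..d0 i} = {}"
      then have "d0 i + s < d" "(\<Sum>j | j < n \<and> X i j \<omega> \<in> {d0 i<..d}. noise.\<phi> (\<xi> i j \<omega>)) \<le> 0"
        by simp_all
      then show ?thesis using \<omega>(1) by blast
    qed (use s in auto)
    then show "\<omega> \<in> R" using R(2) L(2) \<omega>(2) by blast
  qed
  moreover have "prob (R \<union> L) \<le> 2 * exp (exp l - 1) / (1 - exp (- (1 - \<rho>))) * exp (- (1 - \<rho>) * (real n * p))"
    using measure_Un_le[OF R(1) L(1)] order_trans[OF R(3) mono[OF window(1)]]
      order_trans[OF L(3) mono[OF window(2)]] by simp
  moreover have "R \<union> L \<in> events" using R(1) L(1) by auto
  ultimately show ?thesis by blast
qed

lemma l1_max_error_tail:
  fixes m :: "nat \<Rightarrow> nat" and t c :: real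
  defines "\<mu> \<equiv> \<integral>e. noise.\<phi> e \<partial>N"
  assumes c: "0 < c" "c \<le> \<mu>\<^sup>2 / 4"
    and m: "filterlim m at_top sequentially"
    and n_dominates: "filterlim (\<lambda>n. real n / ln (real (m n))) at_top sequentially"
    and t: "0 < t"
  shows "\<forall>\<^sub>F n in sequentially.
           prob {\<omega> \<in> space M. ereal (real n / ln (real (m n))) *
               (MAX i\<in>{..<m n}. \<bar>l1_estimator d0 X \<xi> n i \<omega> - ereal (d0 i)\<bar>) > ereal t}
           \<le> 2 * exp (- c) / (1 - exp (- c)) *
               exp (- (ln (real (m n)) * (t * (fd0 / 2) * (1 - exp (- c)) - 1)))"
proof -
  define l where "l = \<mu> / 2"
  have l: "0 < l" using noise.\<phi>_mean_pos by (simp add: l_def \<mu>_def)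
  define \<rho> where "\<rho> = (\<integral>e. exp (- l * noise.\<phi> e) \<partial>N)"
  define \<kappa> where "\<kappa> = 1 - exp (- c)"
  have "\<rho> \<le> exp (- (\<mu>\<^sup>2 / 4))"
    using noise.\<phi>_laplace by (simp add: \<rho>_def l_def \<mu>_def)
  also have "\<dots> \<le> exp (- c)" using c by simp
  finally have \<kappa>: "\<kappa> \<le> 1 - \<rho>" "0 < \<kappa>" using c by (auto simp: \<kappa>_def)
  then have "\<rho> < 1" by simp
  define C where "C = 2 * exp (exp l - 1) / (1 - exp (- (1 - \<rho>)))"
  have C: "0 \<le> C" using \<open>\<rho> < 1\<close> by (simp add: C_def)
  obtain \<delta> where \<delta>: "0 < \<delta>"
    and window: "\<And>i a b. \<lbrakk>-\<delta> < a; a \<le> b; b < \<delta>\<rbrakk> \<Longrightarrow> 3/4 * fd0 * (b - a) \<le> measure X_law {d0 i + a <.. d0 i + b}"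
    using X_law_window by metis
  have ln_m: "filterlim (\<lambda>n. ln (real (m n))) at_top sequentially"
    by (rule filterlim_compose[OF ln_at_top])
       (rule filterlim_compose[OF filterlim_real_sequentially m])
  \<comment> \<open>the exponent \<open>3/4\<close> that is available minus the \<open>1/2\<close> that is claimed leaves \<open>1/4\<close> to absorb \<open>C\<close>\<close>
  have "((\<lambda>n. C * exp (- (\<kappa> * (fd0 / 4) * t * ln (real (m n))))) \<longlongrightarrow> C * 0) sequentially"
  proof (intro tendsto_mult_left)
    have "filterlim (\<lambda>n. \<kappa> * (fd0 / 4) * t * ln (real (m n))) at_top sequentially"
      using \<kappa> t density_pos by (intro filterlim_tendsto_pos_mult_at_top[OF tendsto_const _ ln_m]) auto
    then show "((\<lambda>n. exp (- (\<kappa> * (fd0 / 4) * t * ln (real (m n))))) \<longlongrightarrow> 0) sequentially"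
      by (intro filterlim_compose[OF exp_at_bot]) (simp add: filterlim_uminus_at_top)
  qed
  moreover have "C * 0 < 2 * exp (- c) / \<kappa>" using \<kappa> by simp
  ultimately have ev1: "\<forall>\<^sub>F n in sequentially. C * exp (- (\<kappa> * (fd0 / 4) * t * ln (real (m n)))) < 2 * exp (- c) / \<kappa>"
    by (rule order_tendstoD(2))
  have ev2: "\<forall>\<^sub>F n in sequentially. t / \<delta> < real n / ln (real (m n))"
    using n_dominates by (simp add: filterlim_at_top_dense)
  have ev3: "\<forall>\<^sub>F n in sequentially. 0 < ln (real (m n))"
    using ln_m by (simp add: filterlim_at_top_dense)
  show ?thesis
    using ev1 ev2 ev3 eventually_gt_at_top[of 0]
  proof eventually_elim
    case (elim n)
    note ln_pos = elim(3)
    then have m_pos: "0 < m n" by (cases "m n") auto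
    \<comment> \<open>an error above \<open>s\<close> is exactly one whose rescaled value exceeds \<open>t\<close>\<close>
    define s where "s = t * ln (real (m n)) / real n"
    have s: "0 < s" "s < \<delta>"
      using elim t \<delta> ln_pos by (auto simp: s_def field_simps)
    have "\<forall>i\<in>{..<m n}. \<exists>B. B \<in> events
        \<and> {\<omega> \<in> space M. ereal s < \<bar>l1_estimator d0 X \<xi> n i \<omega> - ereal (d0 i)\<bar>} \<subseteq> B
        \<and> prob B \<le> C * exp (- (1 - \<rho>) * (real n * (3/4 * fd0 * s)))"
    proof
      fix i
      show "\<exists>B. B \<in> events
        \<and> {\<omega> \<in> space M. ereal s < \<bar>l1_estimator d0 X \<xi> n i \<omega> - ereal (d0 i)\<bar>} \<subseteq> B
        \<and> prob B \<le> C * exp (- (1 - \<rho>) * (real n * (3/4 * fd0 * s)))"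
        using l1_error_tail[OF l \<rho>_def \<open>\<rho> < 1\<close> \<open>0 < n\<close> s(1), of "3/4 * fd0 * s" i]
          window[of 0 s i] window[of "- s" 0 i] s \<delta> by (auto simp: C_def)
    qed
    from bchoice[OF this] obtain B where B:
      "\<forall>i\<in>{..<m n}. B i \<in> events
        \<and> {\<omega> \<in> space M. ereal s < \<bar>l1_estimator d0 X \<xi> n i \<omega> - ereal (d0 i)\<bar>} \<subseteq> B i
        \<and> prob (B i) \<le> C * exp (- (1 - \<rho>) * (real n * (3/4 * fd0 * s)))" ..
    let ?E = "{\<omega> \<in> space M. ereal (real n / ln (real (m n))) *
               (MAX i\<in>{..<m n}. \<bar>l1_estimator d0 X \<xi> n i \<omega> - ereal (d0 i)\<bar>) > ereal t}"
    have "?E \<subseteq> (\<Union>i<m n. B i)"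
    proof safe
      fix \<omega> assume \<omega>: "\<omega> \<in> space M" and gt: "ereal (real n / ln (real (m n))) *
               (MAX i\<in>{..<m n}. \<bar>l1_estimator d0 X \<xi> n i \<omega> - ereal (d0 i)\<bar>) > ereal t"
      let ?err = "\<lambda>i. \<bar>l1_estimator d0 X \<xi> n i \<omega> - ereal (d0 i)\<bar>"
      have "(MAX i\<in>{..<m n}. ?err i) \<in> ?err ` {..<m n}"
        using m_pos by (intro Max_in) auto
      then obtain i where i: "i < m n" "(MAX i\<in>{..<m n}. ?err i) = ?err i" by auto
      have "ereal s < ?err i"
        using gt ln_pos \<open>0 < n\<close> unfolding i(2)
        by (cases "?err i") (auto simp: s_def field_simps)
      then show "\<omega> \<in> (\<Union>i<m n. B i)" using B i(1) \<omega> by blast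
    qed
    then have "prob ?E \<le> prob (\<Union>i<m n. B i)"
      using B by (intro finite_measure_mono) auto
    also have "\<dots> \<le> (\<Sum>i<m n. prob (B i))"
      using B by (intro finite_measure_subadditive_finite) auto
    also have "\<dots> \<le> (\<Sum>i<m n. C * exp (- (1 - \<rho>) * (real n * (3/4 * fd0 * s))))"
      using B by (intro sum_mono) auto
    also have "\<dots> = real (m n) * (C * exp (- (1 - \<rho>) * (3/4 * fd0 * t * ln (real (m n)))))"
      using \<open>0 < n\<close> by (simp add: s_def)
    also have "\<dots> \<le> real (m n) * (C * exp (- \<kappa> * (3/4 * fd0 * t * ln (real (m n)))))"
    proof (intro mult_left_mono C)
      have "\<kappa> * (3/4 * fd0 * t * ln (real (m n))) \<le> (1 - \<rho>) * (3/4 * fd0 * t * ln (real (m n)))"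
        using \<kappa>(1) density_pos t ln_pos by (intro mult_right_mono) auto
      then show "exp (- (1 - \<rho>) * (3/4 * fd0 * t * ln (real (m n)))) \<le> exp (- \<kappa> * (3/4 * fd0 * t * ln (real (m n))))"
        by (simp only: exp_le_cancel_iff mult_minus_left neg_le_iff_le)
    qed auto
    also have "\<dots> = (C * exp (- (\<kappa> * (fd0 / 4) * t * ln (real (m n)))))
        * exp (- (ln (real (m n)) * (t * (fd0 / 2) * \<kappa> - 1)))"
    proof -
      have "exp (ln (real (m n))) = real (m n)" using m_pos by simp
      then have "real (m n) * (C * exp (- \<kappa> * (3/4 * fd0 * t * ln (real (m n)))))
         = C * (exp (ln (real (m n))) * exp (- \<kappa> * (3/4 * fd0 * t * ln (real (m n)))))"
        by simp
      also have "exp (ln (real (m n))) * exp (- \<kappa> * (3/4 * fd0 * t * ln (real (m n))))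
        = exp (- (\<kappa> * (fd0 / 4) * t * ln (real (m n)))) * exp (- (ln (real (m n)) * (t * (fd0 / 2) * \<kappa> - 1)))"
        unfolding exp_add[symmetric] by (intro arg_cong[where f = exp]) (simp add: algebra_simps)
      finally show ?thesis by simp
    qed
    also have "\<dots> \<le> 2 * exp (- c) / \<kappa> * exp (- (ln (real (m n)) * (t * (fd0 / 2) * \<kappa> - 1)))"
      using elim(1) by (intro mult_right_mono) auto
    finally show ?case by (simp add: \<kappa>_def)
  qed
qed

end

section \<open>The squared loss\<close>

text \<open>
  A union bound for the events \<open>A k\<close> and Markov's inequality for the number of the events \<open>V k\<close>, both
  carried out on \<open>J\<close>.  Hence only the joint probabilities with \<open>J\<close> enter.
\<close>

lemma (in prob_space) prob_undisturbed:
  assumes J [measurable]: "J \<in> events"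
    and fin: "finite I" "finite I'"
    and A [measurable]: "\<And>k. k \<in> I \<Longrightarrow> A k \<in> events"
    and V [measurable]: "\<And>k. k \<in> I' \<Longrightarrow> V k \<in> events"
    and a: "\<And>k. k \<in> I \<Longrightarrow> prob (J \<inter> A k) \<le> prob J * a k"
    and v: "\<And>k. k \<in> I' \<Longrightarrow> prob (J \<inter> V k) \<le> prob J * v k"
    and R: "0 < R"
  shows "{\<omega> \<in> J. (\<forall>k\<in>I. \<omega> \<notin> A k) \<and> (\<Sum>k\<in>I'. indicator (V k) \<omega>) \<le> R} \<in> events"
    and "prob J * (1 - (\<Sum>k\<in>I. a k) - (\<Sum>k\<in>I'. v k) / R)
      \<le> prob {\<omega> \<in> J. (\<forall>k\<in>I. \<omega> \<notin> A k) \<and> (\<Sum>k\<in>I'. indicator (V k) \<omega>) \<le> R}"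
proof -
  let ?N = "\<lambda>\<omega>. \<Sum>k\<in>I'. indicator (V k) \<omega> :: real"
  let ?G = "{\<omega> \<in> J. (\<forall>k\<in>I. \<omega> \<notin> A k) \<and> ?N \<omega> \<le> R}"
  let ?D = "\<Union>k\<in>I. J \<inter> A k" and ?C = "{\<omega> \<in> space M. \<omega> \<in> J \<and> R < ?N \<omega>}"
  have D: "?D \<in> events" using fin(1) A J by (intro sets.finite_UN) auto
  have N [measurable]: "?N \<in> borel_measurable M" using V by (intro borel_measurable_sum) auto
  have C: "?C \<in> events" by measurable
  have J_space: "J \<subseteq> space M" using J by (rule sets.sets_into_space)
  have G_eq: "?G = J - ?D - ?C" using J_space by (auto simp: not_less)
  then show G: "?G \<in> events" using J D C by auto
  have "J \<subseteq> ?G \<union> (?D \<union> ?C)" using J_space by (auto simp: not_less)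
  then have "prob J \<le> prob (?G \<union> (?D \<union> ?C))" using G D C by (intro finite_measure_mono) auto
  also have "\<dots> \<le> prob ?G + prob (?D \<union> ?C)" using G D C by (intro measure_Un_le) auto
  also have "prob (?D \<union> ?C) \<le> prob ?D + prob ?C" using D C by (intro measure_Un_le) auto
  also have "prob ?D \<le> (\<Sum>k\<in>I. prob (J \<inter> A k))"
    using fin A J by (intro finite_measure_subadditive_finite) auto
  also have "\<dots> \<le> (\<Sum>k\<in>I. prob J * a k)" by (intro sum_mono a)
  also have "prob ?C \<le> (\<Sum>k\<in>I'. prob J * v k) / R"
  proof -
    have int: "integrable M (indicator (J \<inter> V k) :: _ \<Rightarrow> real)" if "k \<in> I'" for k
      using V[OF that] J by (intro integrable_real_indicator) (auto simp: emeasure_eq_measure)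
    have "prob ?C = (\<integral>\<omega>. indicator ?C \<omega> \<partial>M)" using C by simp
    also have "\<dots> \<le> (\<integral>\<omega>. (\<Sum>k\<in>I'. indicator (J \<inter> V k) \<omega>) / R \<partial>M)"
    proof (rule integral_mono)
      show "integrable M (indicator ?C :: _ \<Rightarrow> real)"
        by (rule integrable_real_indicator[OF C]) (simp add: emeasure_eq_measure)
      show "integrable M (\<lambda>\<omega>. (\<Sum>k\<in>I'. indicator (J \<inter> V k) \<omega>) / R :: real)"
        by (intro integrable_divide Bochner_Integration.integrable_sum int)
      fix \<omega>
      have "(\<Sum>k\<in>I'. indicator (J \<inter> V k) \<omega>) = indicator J \<omega> * ?N \<omega>"
        by (simp add: sum_distrib_left indicator_inter_arith)
      then show "(indicator ?C \<omega> :: real) \<le> (\<Sum>k\<in>I'. indicator (J \<inter> V k) \<omega>) / R"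
        using R by (auto simp: indicator_def field_simps intro!: sum_nonneg)
    qed
    also have "\<dots> = (\<Sum>k\<in>I'. (\<integral>\<omega>. indicator (J \<inter> V k) \<omega> \<partial>M)) / R"
      by (subst Bochner_Integration.integral_sum[symmetric]) (auto intro: int)
    also have "\<dots> = (\<Sum>k\<in>I'. prob (J \<inter> V k)) / R"
      using V J by (intro arg_cong[where f = "\<lambda>z. z / R"] sum.cong refl) (simp add: sets.Int)
    also have "\<dots> \<le> (\<Sum>k\<in>I'. prob J * v k) / R"
      using R by (intro divide_right_mono sum_mono v) auto
    finally show ?thesis .
  qed
  finally show "prob J * (1 - (\<Sum>k\<in>I. a k) - (\<Sum>k\<in>I'. v k) / R) \<le> prob ?G"
    by (simp only: sum_distrib_left[symmetric]) (simp add: algebra_simps)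
qed

text \<open>
  Passing from \<open>d\<close> to \<open>d0 + 3 s\<close> changes the loss by at most \<open>2 e k + 1\<close> for each observation in between.  The
  observation \<open>j\<close> gains at least \<open>2 T - 1\<close>, which outweighs the \<open>R\<close> others with noise below \<open>\<tau>\<close>.
\<close>

lemma l2_minimizer_follows_jump:
  fixes x e :: "nat \<Rightarrow> real"
  assumes j: "j < n" "x j \<in> {d0 + 2 * s<..d0 + 3 * s}" "e j \<le> - T"
    and light: "\<And>k. k < n \<Longrightarrow> k \<noteq> j \<Longrightarrow> x k \<in> {d0 - 2 * s<..d0 + 3 * s} \<Longrightarrow> \<bar>e k\<bar> < \<tau>"
    and few: "(\<Sum>k\<in>{..<n} - {j}. indicator {d0 - 2 * s<..d0 + 3 * s} (x k)) \<le> R"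
    and big: "1 + R * (1 + 2 * \<tau>) < 2 * T" and \<tau>: "0 < \<tau>" and s: "0 < s"
  shows "ereal s < \<bar>smallest_minimizer (l2_loss n x (\<lambda>j. response d0 (x j) (e j))) - ereal d0\<bar>"
proof (rule smallest_minimizer_escapes[OF _ s])
  fix d assume d: "\<bar>d - d0\<bar> \<le> 2 * s"
  let ?W = "{d0 - 2 * s<..d0 + 3 * s}"
  define g where "g k = (response d0 (x k) (e k) - indicator {d0 + 3 * s<..} (x k))\<^sup>2
      - (response d0 (x k) (e k) - indicator {d<..} (x k))\<^sup>2" for k
  have d_less: "d < d0 + 3 * s" "d0 - 2 * s \<le> d" "d \<le> d0 + 2 * s"
    using d s by (auto simp: abs_le_iff)
  have g_zero: "g k = 0" if "x k \<notin> {d<..d0 + 3 * s}" for k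
    using that d_less by (auto simp: g_def indicator_def)
  have g_le: "g k \<le> 2 * e k + 1" if "x k \<in> {d<..d0 + 3 * s}" for k
    using that by (auto simp: g_def indicator_def response_def power2_eq_square algebra_simps)
  have "g j \<le> 1 - 2 * T" using g_le[of j] j d_less by auto
  moreover have "(\<Sum>k\<in>{..<n} - {j}. g k) \<le> R * (1 + 2 * \<tau>)"
  proof -
    have "(\<Sum>k\<in>{..<n} - {j}. g k) \<le> (\<Sum>k\<in>{..<n} - {j}. indicator ?W (x k) * (1 + 2 * \<tau>))"
    proof (rule sum_mono)
      fix k assume k: "k \<in> {..<n} - {j}"
      show "g k \<le> indicator ?W (x k) * (1 + 2 * \<tau>)"
      proof (cases "x k \<in> {d<..d0 + 3 * s}")
        case True
        then have "x k \<in> ?W" using d_less by auto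
        then show ?thesis using light[of k] k g_le[OF True] by auto
      next
        case False
        then show ?thesis using g_zero \<tau> by (simp add: indicator_def)
      qed
    qed
    also have "\<dots> = (\<Sum>k\<in>{..<n} - {j}. indicator ?W (x k)) * (1 + 2 * \<tau>)"
      by (simp add: sum_distrib_right)
    also have "\<dots> \<le> R * (1 + 2 * \<tau>)" using few \<tau> by (intro mult_right_mono) auto
    finally show ?thesis .
  qed
  moreover have "(\<Sum>k<n. g k) = g j + (\<Sum>k\<in>{..<n} - {j}. g k)"
    using j(1) by (simp add: sum.remove)
  ultimately have "(\<Sum>k<n. g k) < 0" using big by simp
  then show "l2_loss n x (\<lambda>j. response d0 (x j) (e j)) (d0 + 3 * s)
      < l2_loss n x (\<lambda>j. response d0 (x j) (e j)) d"
    by (simp add: l2_loss_def g_def sum_subtractf)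
qed

context change_point_problems
begin

lemma prob_pair_rectangle:
  assumes [measurable]: "A \<in> sets borel" "E \<in> sets borel"
  shows "prob {\<omega> \<in> space M. X i j \<omega> \<in> A \<and> \<xi> i j \<omega> \<in> E} = measure X_law A * measure N E"
proof -
  have "prob {\<omega> \<in> space M. X i j \<omega> \<in> A \<and> \<xi> i j \<omega> \<in> E}
      = prob ((\<lambda>\<omega>. (X i j \<omega>, \<xi> i j \<omega>)) -` (A \<times> E) \<inter> space M)"
    by (rule arg_cong[where f = prob]) auto
  also have "\<dots> = prob (X i j -` A \<inter> space M) * prob (\<xi> i j -` E \<inter> space M)"
    by (rule indep_varD[OF noise_indep]) auto
  also have "prob (X i j -` A \<inter> space M) = measure X_law A"
    using distr_X[of i j] by (metis X_measurable assms(1) measure_distr)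
  also have "prob (\<xi> i j -` E \<inter> space M) = measure N E"
    using noise_law[of i j] by (metis noise_measurable assms(2) measure_distr)
  finally show ?thesis .
qed

lemma distinct_pairs_indep:
  assumes "(i, j) \<noteq> (i', j')" and [measurable]: "S \<in> sets (borel \<Otimes>\<^sub>M borel)" "S' \<in> sets (borel \<Otimes>\<^sub>M borel)"
  shows "prob ({\<omega> \<in> space M. (X i j \<omega>, \<xi> i j \<omega>) \<in> S} \<inter> {\<omega> \<in> space M. (X i' j' \<omega>, \<xi> i' j' \<omega>) \<in> S'})
    = prob {\<omega> \<in> space M. (X i j \<omega>, \<xi> i j \<omega>) \<in> S} * prob {\<omega> \<in> space M. (X i' j' \<omega>, \<xi> i' j' \<omega>) \<in> S'}"
proof -
  let ?V = "\<lambda>(i, j) \<omega>. (X i j \<omega>, \<xi> i j \<omega>)" and ?S = "\<lambda>p. if p = (i, j) then S else S'"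
  have "prob (\<Inter>p\<in>{(i, j), (i', j')}. ?V p -` ?S p \<inter> space M)
      = (\<Prod>p\<in>{(i, j), (i', j')}. prob (?V p -` ?S p \<inter> space M))"
    by (rule indep_varsD[OF pairs_indep]) auto
  moreover have "(\<Inter>p\<in>{(i, j), (i', j')}. ?V p -` ?S p \<inter> space M)
      = {\<omega> \<in> space M. (X i j \<omega>, \<xi> i j \<omega>) \<in> S} \<inter> {\<omega> \<in> space M. (X i' j' \<omega>, \<xi> i' j' \<omega>) \<in> S'}"
    using assms(1) by auto
  moreover have "(\<Prod>p\<in>{(i, j), (i', j')}. prob (?V p -` ?S p \<inter> space M))
      = prob {\<omega> \<in> space M. (X i j \<omega>, \<xi> i j \<omega>) \<in> S} * prob {\<omega> \<in> space M. (X i' j' \<omega>, \<xi> i' j' \<omega>) \<in> S'}"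
    using assms(1) by (auto simp: vimage_def Int_def conj_commute)
  ultimately show ?thesis by simp
qed

lemma l2_estimator_measurable [measurable]: "l2_estimator d0 X \<xi> n i \<in> borel_measurable M"
  unfolding l2_estimator_def[abs_def] l2_loss_eq_m_loss
  by (rule measurable_smallest_minimizer_m_loss) (auto simp: response_def)

end

context power_tail_change_points
begin

text \<open>
  The lower bound \<open>m n P(jump) / 4\<close> for the probability of an isolated jump, with \<open>a = 1 + 10 fd0 t\<close> bounding
  the expected number of observations in the window in units of \<open>m powr (1 / \<gamma>)\<close>.
\<close>

definition jump_constant :: "real \<Rightarrow> real" where
  "jump_constant t = 3 * fd0 * t / (256 * (1 + 10 * fd0 * t) * (12 * (1 + 10 * fd0 * t)) powr \<gamma>)"

lemma jump_constant_pos: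
  assumes "0 < t"
  shows "0 < jump_constant t"
proof -
  define a where "a = 1 + 10 * fd0 * t"
  have "0 < fd0 * t" using density_pos assms by simp
  then have "0 < a" unfolding a_def by (simp add: mult.assoc)
  then show ?thesis
    using density_pos assms by (simp add: jump_constant_def a_def[symmetric])
qed

text \<open>
  \<open>J\<close> are the jumps, \<open>H\<close> the observations in the window \<open>Ww\<close> with noise above \<open>\<tau>\<close>, and \<open>W\<close> all observations in the
  window.  A jump is isolated if no other observation of its problem is in \<open>H\<close>, no observation of another
  problem is a jump, and at most \<open>R\<close> others are in the window.  Since \<open>J \<subseteq> H\<close>, two different observations cannot
  both be isolated jumps, so the probabilities add up.  The three smallness assumptions each cost at most
  a quarter of the probability of a jump.
\<close>

lemma isolated_jump_prob:
  fixes J H W :: "nat \<Rightarrow> nat \<Rightarrow> 'a set" and n m :: nat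
  assumes windows: "\<And>i. Rw i \<in> sets borel" "\<And>i. Ww i \<in> sets borel" "\<And>i. Rw i \<subseteq> Ww i"
    and levels: "0 < \<tau>" "\<tau> \<le> T"
    and J: "\<And>i j. J i j = {\<omega> \<in> space M. X i j \<omega> \<in> Rw i \<and> \<xi> i j \<omega> \<in> {..-T}}"
    and H: "\<And>i j. H i j = {\<omega> \<in> space M. X i j \<omega> \<in> Ww i \<and> \<xi> i j \<omega> \<in> {e. \<tau> \<le> \<bar>e\<bar>}}"
    and W: "\<And>i j. W i j = {\<omega> \<in> space M. X i j \<omega> \<in> Ww i}"
    and probs: "\<And>i. i < m \<Longrightarrow> measure X_law (Ww i) \<le> w"
      "\<And>i. i < m \<Longrightarrow> r \<le> measure X_law (Rw i) \<and> measure X_law (Rw i) \<le> r'"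
    and small: "real n * w * measure N {e. \<tau> \<le> \<bar>e\<bar>} \<le> 1/4"
      "real m * real n * r' * measure N {..-T} \<le> 1/4"
      "real n * w \<le> R / 4" and R: "0 < R" and nonneg: "0 \<le> w" "0 \<le> r'"
    and E: "E \<in> events"
    and implies_E: "\<And>i j \<omega>. \<lbrakk>i < m; j < n; \<omega> \<in> J i j; \<And>k. k < n \<Longrightarrow> k \<noteq> j \<Longrightarrow> \<omega> \<notin> H i k;
        (\<Sum>k\<in>{..<n} - {j}. indicator (W i k) \<omega>) \<le> R\<rbrakk> \<Longrightarrow> \<omega> \<in> E"
  shows "real m * real n * (r * measure N {..-T}) / 4 \<le> prob E"
proof -
  note [measurable] = windows(1,2)
  let ?N = "measure N {..-T}" and ?h = "measure N {e. \<tau> \<le> \<bar>e\<bar>}"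
  define I where "I = {..<m} \<times> {..<n}"
  \<comment> \<open>within a row the weaker disturbance \<open>H\<close> must be excluded, in other rows the jump suffices\<close>
  define A where "A i p = (if fst p = i then H i (snd p) else J (fst p) (snd p))" for i p
  define G where "G p = {\<omega> \<in> J (fst p) (snd p). (\<forall>q\<in>I - {p}. \<omega> \<notin> A (fst p) q)
      \<and> (\<Sum>k\<in>{..<n} - {snd p}. indicator (W (fst p) k) \<omega>) \<le> R}" for p
  have ev [measurable]: "J i j \<in> events" "H i j \<in> events" "W i j \<in> events" for i j
    unfolding J H W by measurable
  have pJ: "prob (J i j) = measure X_law (Rw i) * ?N" for i j
    unfolding J by (rule prob_pair_rectangle) auto
  have pH: "prob (H i j) = measure X_law (Ww i) * ?h" for i j
    unfolding H by (rule prob_pair_rectangle) auto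
  have pW: "prob (W i j) = measure X_law (Ww i)" for i j
    unfolding W by (rule prob_X) auto
  have in_pair: "J i j = {\<omega> \<in> space M. (X i j \<omega>, \<xi> i j \<omega>) \<in> Rw i \<times> {..-T}}"
    "H i j = {\<omega> \<in> space M. (X i j \<omega>, \<xi> i j \<omega>) \<in> Ww i \<times> {e. \<tau> \<le> \<bar>e\<bar>}}"
    "W i j = {\<omega> \<in> space M. (X i j \<omega>, \<xi> i j \<omega>) \<in> Ww i \<times> UNIV}" for i j
    by (auto simp: J H W)
  have indep: "prob (J i j \<inter> J i' j') = prob (J i j) * prob (J i' j')"
    "prob (J i j \<inter> H i' j') = prob (J i j) * prob (H i' j')"
    "prob (J i j \<inter> W i' j') = prob (J i j) * prob (W i' j')" if "(i, j) \<noteq> (i', j')" for i j i' j'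
    unfolding in_pair by (rule distinct_pairs_indep[OF that]; simp)+
  have G: "G p \<in> events \<and> prob (J (fst p) (snd p)) / 4 \<le> prob (G p)" if p: "p \<in> I" for p
  proof -
    obtain i j where ij: "p = (i, j)" "i < m" "j < n" using p by (auto simp: I_def)
    define a where "a q = (if fst q = i then w * ?h else r' * ?N)" for q :: "nat \<times> nat"
    have A_ev: "A i q \<in> events" for q by (simp add: A_def)
    have a: "prob (J i j \<inter> A i q) \<le> prob (J i j) * a q" if q: "q \<in> I - {p}" for q
    proof -
      obtain i' j' where q': "q = (i', j')" "i' < m" "(i, j) \<noteq> (i', j')"
        using q ij(1) by (auto simp: I_def)
      have "prob (J i j \<inter> A i q) = prob (J i j) * prob (A i q)"
        using indep[OF q'(3)] by (auto simp: A_def q'(1))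
      moreover have "prob (A i q) \<le> a q"
        using probs(1)[OF q'(2)] probs(2)[OF q'(2)]
        by (auto simp: A_def a_def q'(1) pJ pH intro!: mult_right_mono)
      ultimately show ?thesis by (simp add: mult_left_mono)
    qed
    have v: "prob (J i j \<inter> W i k) \<le> prob (J i j) * w" if "k \<in> {..<n} - {j}" for k
      using indep(3)[of i j i k] that probs(1)[OF ij(2)] by (auto simp: pW mult_left_mono)
    have sum_a: "(\<Sum>q\<in>I - {p}. a q) \<le> 1/2"
    proof -
      have "(\<Sum>q\<in>I - {p}. a q) \<le> (\<Sum>q\<in>I. a q)"
        using nonneg by (intro sum_mono2) (auto simp: I_def a_def)
      also have "\<dots> = (\<Sum>i'<m. \<Sum>j'<n. a (i', j'))"
        unfolding I_def by (subst sum.cartesian_product) simp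
      also have "\<dots> = (\<Sum>i'<m. real n * (if i' = i then w * ?h else r' * ?N))"
        by (simp add: a_def)
      also have "\<dots> \<le> (\<Sum>i'<m. (if i' = i then real n * w * ?h else 0) + real n * r' * ?N)"
        using nonneg by (intro sum_mono) auto
      also have "\<dots> = real n * w * ?h + real m * real n * r' * ?N"
        using ij(2) by (simp add: sum.distrib)
      also have "\<dots> \<le> 1/2" using small by simp
      finally show ?thesis .
    qed
    have sum_v: "(\<Sum>k\<in>{..<n} - {j}. w) / R \<le> 1/4"
    proof -
      have "(\<Sum>k\<in>{..<n} - {j}. w) \<le> real n * w"
        using nonneg(1) card_mono[of "{..<n}" "{..<n} - {j}"] by (simp add: mult_right_mono)
      then have "(\<Sum>k\<in>{..<n} - {j}. w) \<le> R / 4" using small(3) by linarith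
      then show ?thesis using R by (simp add: field_simps)
    qed
    have "finite (I - {p})" "finite ({..<n} - {j})" by (auto simp: I_def)
    note prob_undisturbed[OF ev(1) this A_ev ev(3) a v R]
    then have "G p \<in> events" "prob (J i j) * (1 - (\<Sum>q\<in>I - {p}. a q) - (\<Sum>k\<in>{..<n} - {j}. w) / R) \<le> prob (G p)"
      by (simp_all add: G_def ij(1))
    moreover from this(2) have "prob (J i j) * (1/4) \<le> prob (G p)"
    proof (rule order_trans[rotated])
      show "prob (J i j) * (1/4) \<le> prob (J i j) * (1 - (\<Sum>q\<in>I - {p}. a q) - (\<Sum>k\<in>{..<n} - {j}. w) / R)"
        using sum_a sum_v by (intro mult_left_mono) auto
    qed
    ultimately show ?thesis by (simp add: ij(1))
  qed
  have J_sub_H: "J i j \<subseteq> H i j" for i j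
    using windows(3)[of i] levels by (auto simp: J H)
  have disj: "disjoint_family_on G I"
  proof (unfold disjoint_family_on_def, intro ballI impI)
    fix p q assume pq: "p \<in> I" "q \<in> I" "p \<noteq> q"
    have False if \<omega>: "\<omega> \<in> G p" "\<omega> \<in> G q" for \<omega>
    proof -
      have "\<omega> \<in> J (fst q) (snd q)" using \<omega>(2) by (simp add: G_def)
      then have "\<omega> \<in> A (fst p) q" using J_sub_H[of "fst q" "snd q"] by (auto simp: A_def)
      then show False using \<omega>(1) pq by (auto simp: G_def)
    qed
    then show "G p \<inter> G q = {}" by auto
  qed
  have G_sub: "G p \<subseteq> E" if p: "p \<in> I" for p
  proof
    fix \<omega> assume \<omega>: "\<omega> \<in> G p"
    obtain i j where ij: "p = (i, j)" "i < m" "j < n" using p by (auto simp: I_def)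
    show "\<omega> \<in> E"
    proof (rule implies_E[OF ij(2,3)])
      show "\<omega> \<in> J i j" "(\<Sum>k\<in>{..<n} - {j}. indicator (W i k) \<omega>) \<le> R"
        using \<omega> by (auto simp: G_def ij(1))
      show "\<omega> \<notin> H i k" if "k < n" "k \<noteq> j" for k
      proof -
        have "(i, k) \<in> I - {p}" using that ij by (auto simp: I_def)
        then have "\<omega> \<notin> A i (i, k)" using \<omega> by (auto simp: G_def ij(1))
        then show ?thesis by (simp add: A_def)
      qed
    qed
  qed
  have "real m * real n * (r * ?N) / 4 = (\<Sum>p\<in>I. r * ?N / 4)"
    by (simp add: I_def)
  also have "\<dots> \<le> (\<Sum>p\<in>I. prob (G p))"
  proof (rule sum_mono)
    fix p assume p: "p \<in> I"
    then have "r * ?N \<le> prob (J (fst p) (snd p))"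
      using probs(2)[of "fst p"] by (auto simp: I_def pJ intro!: mult_right_mono)
    then show "r * ?N / 4 \<le> prob (G p)" using G[OF p] by linarith
  qed
  also have "\<dots> = prob (\<Union>p\<in>I. G p)"
    using G disj by (intro finite_measure_finite_Union[symmetric]) (auto simp: I_def)
  also have "\<dots> \<le> prob E" using G_sub E by (intro finite_measure_mono) auto
  finally show ?thesis .
qed

text \<open>
  With \<open>k = m powr (1 / \<gamma>)\<close> the window contains at most \<open>a k\<close> observations on average, \<open>\<tau>\<close> is chosen so that
  the expected number of those with noise above \<open>\<tau>\<close> is at most \<open>1/4\<close>, and \<open>T\<close> so that a jump outweighs \<open>4 a k\<close> observations with
  noise up to \<open>\<tau>\<close>.  Then \<open>T powr \<gamma>\<close> lies between constant multiples of \<open>m k\<close>, so that the expected number of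
  jumps in all problems together is bounded from both sides.
\<close>

lemma l2_max_error_lower_bound:
  fixes m :: "nat \<Rightarrow> nat" and t :: real
  assumes m: "filterlim m at_top sequentially"
    and n_dominates: "filterlim (\<lambda>n. real n / real (m n) powr (1 / \<gamma>)) at_top sequentially"
    and t: "0 < t"
  shows "\<forall>\<^sub>F n in sequentially. jump_constant t \<le>
           prob {\<omega> \<in> space M. (MAX i\<in>{..<m n}. ereal (real n / real (m n) powr (1 / \<gamma>)) *
                   \<bar>l2_estimator d0 X \<xi> n i \<omega> - ereal (d0 i)\<bar>) > ereal t}"
proof -
  obtain \<delta> where \<delta>: "0 < \<delta>" and window:
    "\<And>i a b. \<lbrakk>-\<delta> < a; a \<le> b; b < \<delta>\<rbrakk> \<Longrightarrow> 3/4 * fd0 * (b - a) \<le> measure X_law {d0 i + a <.. d0 i + b}"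
    "\<And>i a b. \<lbrakk>-\<delta> < a; a \<le> b; b < \<delta>\<rbrakk> \<Longrightarrow> measure X_law {d0 i + a <.. d0 i + b} \<le> 2 * fd0 * (b - a)"
    by (rule X_law_window) blast
  have ev1: "\<forall>\<^sub>F n in sequentially. 3 * t / \<delta> < real n / real (m n) powr (1 / \<gamma>)"
    using n_dominates by (simp add: filterlim_at_top_dense)
  have ev2: "\<forall>\<^sub>F n in sequentially. 0 < m n"
    using m[unfolded filterlim_at_top, rule_format, of 1] by eventually_elim simp
  show ?thesis
    using ev1 ev2 eventually_gt_at_top[of 0]
  proof eventually_elim
    case (elim n)
    define k where "k = real (m n) powr (1 / \<gamma>)"
    define a where "a = 1 + 10 * fd0 * t"
    define s where "s = t * k / real n"
    define \<tau> where "\<tau> = (4 * a * k) powr (1 / \<gamma>)"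
    define T where "T = 1 + 4 * a * k * (1 + \<tau>)"
    have \<gamma>: "0 < \<gamma>" by (rule noise.tail_index)
    have k: "1 \<le> k" unfolding k_def using elim(2) \<gamma> by (intro ge_one_powr_ge_zero) auto
    have k_powr: "k powr \<gamma> = real (m n)" using \<gamma> elim(2) by (simp add: k_def powr_powr)
    have n: "0 < real n" using elim(3) by simp
    have fd0_t: "0 < fd0 * t" using density_pos t by simp
    have a: "1 \<le> a" "10 * (fd0 * t) \<le> a" using fd0_t by (auto simp: a_def)
    have ak: "1 \<le> a * k" using mult_mono[OF a(1) k] a k by simp
    have s: "0 < s" "3 * s < \<delta>"
      using elim t \<delta> k n by (auto simp: s_def k_def[symmetric] field_simps)
    have \<tau>_powr: "\<tau> powr \<gamma> = 4 * a * k" using \<gamma> ak by (simp add: \<tau>_def powr_powr)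
    have \<tau>: "1 \<le> \<tau>" unfolding \<tau>_def using ak \<gamma> by (intro ge_one_powr_ge_zero) auto
    have T_lower: "4 * a * k * \<tau> \<le> T" using ak by (simp add: T_def algebra_simps)
    have T_upper: "T \<le> 12 * a * k * \<tau>"
    proof -
      have "1 * 1 \<le> (a * k) * \<tau>" using ak \<tau> by (intro mult_mono) auto
      moreover have "(a * k) * 1 \<le> (a * k) * \<tau>" using ak \<tau> by (intro mult_left_mono) auto
      ultimately show ?thesis by (simp add: T_def algebra_simps)
    qed
    have "1 * \<tau> \<le> (4 * a * k) * \<tau>" using ak \<tau> by (intro mult_right_mono) auto
    then have \<tau>_le_T: "\<tau> \<le> T" using T_lower by simp
    have T: "1 \<le> T" using \<tau>_le_T \<tau> by simp
    have powr_lower: "real (m n) * (4 * a * k) \<le> T powr \<gamma>"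
    proof -
      have "real (m n) * (4 * a * k) = k powr \<gamma> * \<tau> powr \<gamma>" by (simp add: k_powr \<tau>_powr)
      also have "\<dots> = (k * \<tau>) powr \<gamma>" using k \<tau> by (simp add: powr_mult)
      also have "\<dots> \<le> T powr \<gamma>"
      proof (rule powr_mono2)
        have "1 * (k * \<tau>) \<le> 4 * a * (k * \<tau>)" using a k \<tau> by (intro mult_right_mono) auto
        then show "k * \<tau> \<le> T" using T_lower by (simp add: mult.assoc)
      qed (use \<gamma> k \<tau> in auto)
      finally show ?thesis .
    qed
    have powr_upper: "1 + T powr \<gamma> \<le> 2 * ((12 * a) powr \<gamma> * real (m n) * (4 * a * k))"
    proof -
      have "1 \<le> T powr \<gamma>" using T \<gamma> by (intro ge_one_powr_ge_zero) auto
      then have "1 + T powr \<gamma> \<le> 2 * T powr \<gamma>" by simp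
      also have "T powr \<gamma> \<le> (12 * a * k * \<tau>) powr \<gamma>" using T_upper T \<gamma> by (intro powr_mono2) auto
      also have "\<dots> = (12 * a) powr \<gamma> * real (m n) * (4 * a * k)"
        using a k \<tau> by (simp add: powr_mult k_powr[symmetric] \<tau>_powr[symmetric])
      finally show ?thesis by simp
    qed
    have ns: "real n * s = t * k" using n by (simp add: s_def)
    have lower_T: "measure N {..-T} = 1 / (2 * (1 + T powr \<gamma>))" using noise.lower_tail[of T] T by simp
    let ?err = "\<lambda>\<omega> i. ereal (real n / real (m n) powr (1 / \<gamma>)) * \<bar>l2_estimator d0 X \<xi> n i \<omega> - ereal (d0 i)\<bar>"
    let ?E = "{\<omega> \<in> space M. (MAX i\<in>{..<m n}. ?err \<omega> i) > ereal t}"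
    have E: "?E = {\<omega> \<in> space M. \<exists>i\<in>{..<m n}. ereal t < ?err \<omega> i}"
      using elim(2) by (subst Max_gr_iff) auto
    have "jump_constant t \<le> real (m n) * real n * ((3/4 * fd0 * s) * measure N {..-T}) / 4"
    proof -
      have "jump_constant t = 3 * fd0 * t / (256 * a * (12 * a) powr \<gamma>)"
        by (simp only: jump_constant_def a_def)
      also have "\<dots> = 3 * fd0 * (t * k) * real (m n) / (32 * (2 * ((12 * a) powr \<gamma> * real (m n) * (4 * a * k))))"
        using k elim(2) by (simp add: mult.assoc mult.left_commute mult.commute)
      also have "\<dots> \<le> 3 * fd0 * (t * k) * real (m n) / (32 * (1 + T powr \<gamma>))"
        using powr_upper fd0_t k density_pos t a(1) elim(2) by (intro divide_left_mono) (auto intro!: mult_pos_pos add_pos_nonneg)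
      also have "\<dots> = real (m n) * real n * ((3/4 * fd0 * s) * measure N {..-T}) / 4"
        unfolding lower_T ns[symmetric] by simp
      finally show ?thesis .
    qed
    also have "\<dots> \<le> prob ?E"
    proof (rule isolated_jump_prob[where \<tau> = \<tau> and T = T and w = "10 * fd0 * s" and r' = "2 * fd0 * s" and R = "4 * a * k"
          and Rw = "\<lambda>i. {d0 i + 2 * s<..d0 i + 3 * s}" and Ww = "\<lambda>i. {d0 i - 2 * s<..d0 i + 3 * s}", OF _ _ _ _ _ refl refl refl])
      show "{d0 i + 2 * s<..d0 i + 3 * s} \<subseteq> {d0 i - 2 * s<..d0 i + 3 * s}" for i
        using s by auto
      show "0 < \<tau>" using \<tau> by simp
      show "\<tau> \<le> T" by (rule \<tau>_le_T)
      show "measure X_law {d0 i - 2 * s<..d0 i + 3 * s} \<le> 10 * fd0 * s" for i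
        using window(2)[of "- 2 * s" "3 * s" i] s by simp
      show "3/4 * fd0 * s \<le> measure X_law {d0 i + 2 * s<..d0 i + 3 * s} \<and>
          measure X_law {d0 i + 2 * s<..d0 i + 3 * s} \<le> 2 * fd0 * s" for i
        using window[of "2 * s" "3 * s" i] s by simp
      show "real n * (10 * fd0 * s) * measure N {e. \<tau> \<le> \<bar>e\<bar>} \<le> 1/4"
      proof -
        have "real n * (10 * fd0 * s) * measure N {e. \<tau> \<le> \<bar>e\<bar>} = 10 * (fd0 * t) * k / (1 + 4 * a * k)"
          using noise.tail[of \<tau>] \<tau> ns by (simp add: \<tau>_powr mult.assoc mult.left_commute)
        also have "\<dots> \<le> a * k / (1 + 4 * a * k)"
          using a k by (intro divide_right_mono mult_right_mono) auto
        also have "\<dots> \<le> 1/4" using ak by (simp add: field_simps)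
        finally show ?thesis .
      qed
      show "real (m n) * real n * (2 * fd0 * s) * measure N {..-T} \<le> 1/4"
      proof -
        have "real (m n) * real n * (2 * fd0 * s) * measure N {..-T} = real (m n) * k * (fd0 * t) / (1 + T powr \<gamma>)"
        proof -
          have "real (m n) * real n * (2 * fd0 * s) * (1 / (2 * u)) = real (m n) * fd0 * (real n * s) / u" for u
            by simp
          also have "real (m n) * fd0 * (real n * s) = real (m n) * k * (fd0 * t)"
            unfolding ns by simp
          finally show ?thesis unfolding lower_T .
        qed
        also have "\<dots> \<le> real (m n) * k * a / (1 + T powr \<gamma>)"
          using a k fd0_t by (intro divide_right_mono mult_left_mono) auto
        also have "\<dots> \<le> 1/4"
        proof -
          have "4 * (real (m n) * k * a) \<le> 1 + T powr \<gamma>" using powr_lower by (simp add: algebra_simps)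
          moreover have "0 < 1 + T powr \<gamma>" by (simp add: add_pos_nonneg)
          ultimately show ?thesis by (simp add: divide_le_eq)
        qed
        finally show ?thesis .
      qed
      show "real n * (10 * fd0 * s) \<le> 4 * a * k / 4"
      proof -
        have "real n * (10 * fd0 * s) = 10 * (fd0 * t) * k" using ns by (simp add: mult.left_commute)
        also have "\<dots> \<le> a * k" using a k by (intro mult_right_mono) auto
        finally show ?thesis by simp
      qed
      show "0 < 4 * a * k" using ak by simp
      show "0 \<le> 10 * fd0 * s" "0 \<le> 2 * fd0 * s" using density_pos s by auto
      show "?E \<in> events" unfolding E by measurable
      fix i j \<omega>
      assume i: "i < m n" and j: "j < n"
        and J: "\<omega> \<in> {\<omega> \<in> space M. X i j \<omega> \<in> {d0 i + 2 * s<..d0 i + 3 * s} \<and> \<xi> i j \<omega> \<in> {..-T}}"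
        and H: "\<And>l. l < n \<Longrightarrow> l \<noteq> j \<Longrightarrow> \<omega> \<notin> {\<omega> \<in> space M. X i l \<omega> \<in> {d0 i - 2 * s<..d0 i + 3 * s} \<and> \<xi> i l \<omega> \<in> {e. \<tau> \<le> \<bar>e\<bar>}}"
        and W: "(\<Sum>l\<in>{..<n} - {j}. indicator {\<omega> \<in> space M. X i l \<omega> \<in> {d0 i - 2 * s<..d0 i + 3 * s}} \<omega>) \<le> 4 * a * k"
      have \<omega>: "\<omega> \<in> space M" using J by simp
      have "ereal s < \<bar>l2_estimator d0 X \<xi> n i \<omega> - ereal (d0 i)\<bar>"
        unfolding l2_estimator_def
      proof (rule l2_minimizer_follows_jump[where \<tau> = \<tau> and T = T and R = "4 * a * k", OF j])
        show "\<bar>\<xi> i l \<omega>\<bar> < \<tau>" if "l < n" "l \<noteq> j" "X i l \<omega> \<in> {d0 i - 2 * s<..d0 i + 3 * s}" for l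
          using H[OF that(1,2)] that(3) \<omega> by (auto simp: not_le)
        show "(\<Sum>l\<in>{..<n} - {j}. indicator {d0 i - 2 * s<..d0 i + 3 * s} (X i l \<omega>)) \<le> 4 * a * k"
          using W \<omega> by (simp add: indicator_def)
        show "1 + 4 * a * k * (1 + 2 * \<tau>) < 2 * T"
          using ak by (simp add: T_def algebra_simps)
      qed (use J s \<tau> in auto)
      then have "ereal t < ?err \<omega> i"
        using n k by (cases "\<bar>l2_estimator d0 X \<xi> n i \<omega> - ereal (d0 i)\<bar>")
          (auto simp: s_def k_def[symmetric] field_simps)
      then show "\<omega> \<in> ?E" using i \<omega> unfolding E by auto
    qed simp_all
    finally show ?case .
  qed
qed

end

theorem theorem3p1:
  fixes M :: "'a measure"
    and f :: "real \<Rightarrow> real" and fd0 \<gamma> \<mu> b c :: real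
    and N :: "real measure"
    and d0 :: "nat \<Rightarrow> real"
    and X \<xi> :: "nat \<Rightarrow> nat \<Rightarrow> 'a \<Rightarrow> real"
  assumes model: "change_point_problems M f fd0 N d0 X \<xi>"
    and tail_index: "0 < \<gamma>"
    and noise_symmetric: "distr N borel uminus = N"
    and noise_tail: "\<And>t. 0 \<le> t \<Longrightarrow> measure N {e. t \<le> \<bar>e\<bar>} = 1 / (1 + t powr \<gamma>)"
    and mu: "\<mu> = (\<integral>e. \<bar>e + 1\<bar> - \<bar>e\<bar> \<partial>N)"
    and b: "b = essential_range_length N (\<lambda>e. (\<bar>e + 1\<bar> - \<bar>e\<bar>) - \<mu>)"
    and c: "c = \<mu>\<^sup>2 / (4 * b\<^sup>2)"
  shows
    "(\<exists>C :: real \<Rightarrow> real. (\<forall>t>0. 0 < C t) \<and>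
        (\<forall>m :: nat \<Rightarrow> nat.
           filterlim m at_top sequentially \<longrightarrow>
           filterlim (\<lambda>n. real n / real (m n) powr (1 / \<gamma>)) at_top sequentially \<longrightarrow>
           (\<forall>t>0. ereal (C t) \<le>
              liminf (\<lambda>n. ereal (measure M {\<omega> \<in> space M.
                (MAX i\<in>{..<m n}. ereal (real n / real (m n) powr (1 / \<gamma>)) *
                   \<bar>l2_estimator d0 X \<xi> n i \<omega> - ereal (d0 i)\<bar>) > ereal t}))))) \<and>
     (\<forall>m :: nat \<Rightarrow> nat.
        filterlim m at_top sequentially \<longrightarrow>
        filterlim (\<lambda>n. real n / ln (real (m n))) at_top sequentially \<longrightarrow>
        (\<forall>t>0. \<forall>\<^sub>F n in sequentially.
           measure M {\<omega> \<in> space M.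
             ereal (real n / ln (real (m n))) *
               (MAX i\<in>{..<m n}. \<bar>l1_estimator d0 X \<xi> n i \<omega> - ereal (d0 i)\<bar>) > ereal t}
           \<le> 2 * exp (- c) / (1 - exp (- c)) *
               exp (- (ln (real (m n)) * (t * (fd0 / 2) * (1 - exp (- c)) - 1)))))"
proof -
  interpret change_point_problems M f fd0 N d0 X \<xi> by (rule model)
  interpret symmetric_power_tail N \<gamma>
    by unfold_locales (use tail_index noise_symmetric noise_tail in auto)
  interpret P: power_tail_change_points M f fd0 N d0 X \<xi> \<gamma> ..
  have \<mu>: "\<mu> = (\<integral>e. \<phi> e \<partial>N)" by (simp add: mu \<phi>_def)
  have "b = 2" using range_\<phi>[of \<mu>] by (simp add: b \<phi>_def)
  then have "0 < c" "c \<le> \<mu>\<^sup>2 / 4" using \<phi>_mean_pos by (auto simp: c \<mu>)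
  then show ?thesis
    using P.jump_constant_pos P.l2_max_error_lower_bound P.l1_max_error_tail
    unfolding \<mu>
    by (intro conjI exI[of _ P.jump_constant] allI impI Liminf_bounded) (auto simp: eventually_sequentially)
qed

end
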